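(* Let $L>0$, $c\in\mathbb R$, and let $(\phi_c,\psi_c)$ be a positive single-lobe state of the stationary NLS-log system on the tadpole graph $\mathcal G$ (with Neumann–Kirchhoff condition). Consider the self-adjoint operator $$\mathcal L_2=\mathrm{diag}\left(-\partial_x^2+c-\log|\phi_c|^2,\; -\partial_x^2+c-\log|\psi_c|^2\right)$$ on $L^2(\mathcal G)$ with domain $\mathcal D$. Then: 1) $\ker(\mathcal L_2)=\mathrm{span}\{(\phi_c,\psi_c)\}$. 2) $\mathcal L_2$ is a non-negative operator, $\mathcal L_2\ge 0$.
   Context: Tadpole graph: $\mathcal G$ consists of a ring identified with $[-L,L]$ (endpoints $\pm L$ glued) and a half-line $[L,+\infty)$, joined at the single vertex $L$. A function on $\mathcal G$ is a pair $(f,g)$ with $f$ on $[-L,L]$, $g$ on $[L,+\infty)$. $L^2(\mathcal G)=L^2(-L,L)\oplus L^2(L,+\infty)$, $H^n(\mathcal G)=H^n(-L,L)\oplus H^n(L,+\infty)$ with natural norms. $D_0=\{(f,g)\in H^2(\mathcal G): f(L)=f(-L)=g(L),\ f'(L)-f'(-L)=g'(L+)\}$ and $\mathcal D=\{(f,g)\in D_0: x^2g\in L^2(L,+\infty)\}$. Stationary system: real-valued $(\phi,\psi)\in D_0$ with $-\phi''+c\phi-\log(\phi^2)\phi=0$ on $(-L,L)$ and $-\psi''+c\psi-\log(\psi^2)\psi=0$ on $(L,+\infty)$. A positive single-lobe state is a solution $(\phi,\psi)\in D_0$ of this system such that each component is positive on its edge, the maximum of $(\phi,\psi)$ over $\mathcal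 G$ is attained at a single internal point symmetrically located on $[-L,L]$ (i.e. at $x=0$), $\phi$ is monotonically decreasing on $[0,L]$, and $\psi$ is strictly decreasing on $[L,+\infty)$. In that case $\psi_c(x)=e^{\frac{c+1}{2}}e^{-\frac{(x-L+a)^2}{2}}$ for $x\ge L$, with some $a>0$. *)

theory Defs
  imports "HOL-Analysis.Analysis"
begin

text \<open>
  Elements of \<open>L\<^sup>2(I)\<close>, for an open interval \<open>I\<close>, are represented by functions defined on all of
  \<^typ>\<open>real\<close> that are to be read modulo equality almost everywhere on \<open>I\<close>; what a representative
  does outside \<open>I\<close> is irrelevant.  All spaces are complex.
\<close>

definition L2 :: "real set \<Rightarrow> (real \<Rightarrow> complex) \<Rightarrow> bool" where
  "L2 I f \<longleftrightarrow> f \<in> borel_measurable (lebesgue_on I) \<and>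
     integrable (lebesgue_on I) (\<lambda>x. (cmod (f x))\<^sup>2)"

text \<open>
  Test functions in \<open>C\<^sub>c\<^sup>1(I)\<close>, as in Brezis' definition of the Sobolev spaces on an interval.
\<close>

definition test_function :: "real set \<Rightarrow> (real \<Rightarrow> real) \<Rightarrow> bool" where
  "test_function I \<eta> \<longleftrightarrow> \<eta> differentiable_on UNIV \<and> continuous_on UNIV (deriv \<eta>) \<and>
     (\<exists>K. compact K \<and> K \<subseteq> I \<and> (\<forall>x. x \<notin> K \<longrightarrow> \<eta> x = 0))"

definition has_weak_deriv :: "real set \<Rightarrow> (real \<Rightarrow> complex) \<Rightarrow> (real \<Rightarrow> complex) \<Rightarrow> bool" where
  "has_weak_deriv I f g \<longleftrightarrow>
     (\<forall>\<eta>. test_function I \<eta> \<longrightarrow>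
        (LINT x|lebesgue_on I. deriv \<eta> x *\<^sub>R f x) = - (LINT x|lebesgue_on I. \<eta> x *\<^sub>R g x))"

primrec sobolev :: "nat \<Rightarrow> real set \<Rightarrow> (real \<Rightarrow> complex) \<Rightarrow> bool" where
  "sobolev 0 I f \<longleftrightarrow> L2 I f"
| "sobolev (Suc n) I f \<longleftrightarrow> L2 I f \<and> (\<exists>g. has_weak_deriv I f g \<and> sobolev n I g)"

text \<open>
  The weak derivative is determined only up to a null set; this is some representative of it.
\<close>

definition weak_deriv :: "real set \<Rightarrow> (real \<Rightarrow> complex) \<Rightarrow> real \<Rightarrow> complex" where
  "weak_deriv I f = (SOME g. L2 I g \<and> has_weak_deriv I f g)"

text \<open>
  Values at points of the closed interval, in particular at the vertex, are those of the
  continuous representative on \<open>closure I\<close>, which exists and is unique there for \<open>f\<close> in \<open>H\<^sup>1(I)\<close>.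
\<close>

definition continuous_rep :: "real set \<Rightarrow> (real \<Rightarrow> complex) \<Rightarrow> real \<Rightarrow> complex" where
  "continuous_rep I f =
     (SOME h. continuous_on (closure I) h \<and> (AE x in lebesgue_on I. h x = f x))"

type_synonym graph_fun = "(real \<Rightarrow> complex) \<times> (real \<Rightarrow> complex)"

abbreviation ring_edge :: "real \<Rightarrow> real set" where
  "ring_edge L \<equiv> {-L<..<L}"

abbreviation halfline :: "real \<Rightarrow> real set" where
  "halfline L \<equiv> {L<..}"

definition L2_graph :: "real \<Rightarrow> graph_fun set" where
  "L2_graph L = {(f, g). L2 (ring_edge L) f \<and> L2 (halfline L) g}"

definition H_graph :: "nat \<Rightarrow> real \<Rightarrow> graph_fun set" where
  "H_graph n L = {(f, g). sobolev n (ring_edge L) f \<and> sobolev n (halfline L) g}"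

definition graph_ae_eq :: "real \<Rightarrow> graph_fun \<Rightarrow> graph_fun \<Rightarrow> bool" where
  "graph_ae_eq L u v \<longleftrightarrow>
     (AE x in lebesgue_on (ring_edge L). fst u x = fst v x) \<and>
     (AE x in lebesgue_on (halfline L). snd u x = snd v x)"

definition graph_inner :: "real \<Rightarrow> graph_fun \<Rightarrow> graph_fun \<Rightarrow> complex" where
  "graph_inner L u v =
     (LINT x|lebesgue_on (ring_edge L). fst u x * cnj (fst v x)) +
     (LINT x|lebesgue_on (halfline L). snd u x * cnj (snd v x))"

definition D0 :: "real \<Rightarrow> graph_fun set" where
  "D0 L = {(f, g) \<in> H_graph 2 L.
     (let f0 = continuous_rep (ring_edge L) f;
          g0 = continuous_rep (halfline L) g;
          f1 = continuous_rep (ring_edge L) (weak_deriv (ring_edge L) f);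
          g1 = continuous_rep (halfline L) (weak_deriv (halfline L) g)
      in f0 L = f0 (-L) \<and> f0 L = g0 L \<and> f1 L - f1 (-L) = g1 L)}"

definition log_domain :: "real \<Rightarrow> graph_fun set" where
  "log_domain L = {(f, g) \<in> D0 L. L2 (halfline L) (\<lambda>x. x\<^sup>2 *\<^sub>R g x)}"

definition complexify :: "(real \<Rightarrow> real) \<Rightarrow> real \<Rightarrow> complex" where
  "complexify f x = of_real (f x)"

definition stationary_eq :: "real set \<Rightarrow> real \<Rightarrow> (real \<Rightarrow> real) \<Rightarrow> bool" where
  "stationary_eq I c f \<longleftrightarrow>
     (AE x in lebesgue_on I.
        - weak_deriv I (weak_deriv I (complexify f)) x
          + of_real (c * f x - ln ((f x)\<^sup>2) * f x) = 0)"

text \<open>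
  The two continuity requirements single out the representatives for which the pointwise
  conditions (positivity, maximum, monotonicity) are meant; they are no restriction on the
  underlying elements of \<open>H\<^sup>2\<close>.
\<close>

definition positive_single_lobe ::
    "real \<Rightarrow> real \<Rightarrow> (real \<Rightarrow> real) \<Rightarrow> (real \<Rightarrow> real) \<Rightarrow> bool" where
  "positive_single_lobe L c \<phi> \<psi> \<longleftrightarrow>
     continuous_on {-L..L} \<phi> \<and> continuous_on {L..} \<psi> \<and>
     (complexify \<phi>, complexify \<psi>) \<in> D0 L \<and>
     stationary_eq (ring_edge L) c \<phi> \<and> stationary_eq (halfline L) c \<psi> \<and>
     (\<forall>x\<in>{-L..L}. \<phi> x > 0) \<and> (\<forall>x\<in>{L..}. \<psi> x > 0) \<and>
     (\<forall>x\<in>{-L..L}. x \<noteq> 0 \<longrightarrow> \<phi> x < \<phi> 0) \<and> (\<forall>x\<in>{L..}. \<psi> x < \<phi> 0) \<and>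
     monotone_on {0..L} (\<le>) (\<ge>) \<phi> \<and> monotone_on {L..} (<) (>) \<psi>"

definition schroedinger :: "real set \<Rightarrow> (real \<Rightarrow> real) \<Rightarrow> (real \<Rightarrow> complex) \<Rightarrow> real \<Rightarrow> complex" where
  "schroedinger I V f x = - weak_deriv I (weak_deriv I f) x + of_real (V x) * f x"

definition op_L2 ::
    "real \<Rightarrow> real \<Rightarrow> (real \<Rightarrow> real) \<Rightarrow> (real \<Rightarrow> real) \<Rightarrow> graph_fun \<Rightarrow> graph_fun" where
  "op_L2 L c \<phi> \<psi> u =
     (schroedinger (ring_edge L) (\<lambda>x. c - ln (\<bar>\<phi> x\<bar>\<^sup>2)) (fst u),
      schroedinger (halfline L) (\<lambda>x. c - ln (\<bar>\<psi> x\<bar>\<^sup>2)) (snd u))"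

definition graph_kernel :: "real \<Rightarrow> graph_fun set \<Rightarrow> (graph_fun \<Rightarrow> graph_fun) \<Rightarrow> graph_fun set" where
  "graph_kernel L D T = {u \<in> D. graph_ae_eq L (T u) (\<lambda>x. 0, \<lambda>x. 0)}"

definition graph_span :: "real \<Rightarrow> graph_fun \<Rightarrow> graph_fun set" where
  "graph_span L v = {u. \<exists>z. graph_ae_eq L u (\<lambda>x. z * fst v x, \<lambda>x. z * snd v x)}"

text \<open>
  Since \<open>graph_inner\<close> is zero for a non-integrable product, it is part of the definition
  that \<open>T\<close> takes its values in \<open>L\<^sup>2\<close>.
\<close>

definition nonneg_operator :: "real \<Rightarrow> graph_fun set \<Rightarrow> (graph_fun \<Rightarrow> graph_fun) \<Rightarrow> bool" where
  "nonneg_operator L D T \<longleftrightarrow>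
     (\<forall>u\<in>D. T u \<in> L2_graph L \<and> graph_inner L (T u) u \<in> \<real> \<and> 0 \<le> Re (graph_inner L (T u) u))"

end

theory Submission
  imports Defs
begin

text \<open>
  Write \<open>V\<close> for the potential on an edge and \<open>q = u'/u\<close> for the logarithmic derivative of the
  positive solution \<open>u\<close> of \<open>u'' = V u\<close> there, so that \<open>q' = V - q\<^sup>2\<close>.  For \<open>f\<close> in \<open>H\<^sup>2\<close> this gives
  \<open>(- f' cnj f + q \<bar>f\<bar>\<^sup>2)' = (- f'' + V f) cnj f - \<bar>f' - q f\<bar>\<^sup>2\<close>.
  Integrated over both edges, the boundary terms cancel at the vertex, because the state satisfies
  the same Kirchhoff condition as the functions in the domain, and they vanish at infinity, because
  \<open>q\<close> is affine and \<open>V\<close> quadratic on the half-line.  Hence the quadratic form is the integral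
  of \<open>\<bar>f' - q f\<bar>\<^sup>2\<close>, which vanishes only if \<open>f/u\<close> is constant on each edge, and continuity at
  the vertex makes the two constants equal.
\<close>

section \<open>Fubini on a triangle\<close>

text \<open>Every derivative identity is therefore kept in integrated form. The lemma of du
  Bois-Reymond turns weak derivatives into such primitives, and does so up to the endpoints of each
  edge, which is where the vertex conditions are read. The expression \<open>f' - q f\<close> equals
  \<open>u (f/u)'\<close>, the ground-state substitution; positivity of the state makes
  \<open>q\<close> available on the whole closed edge. The delicate end is infinity: boundary terms
  are discarded there because the flux is itself integrable, and this rests on the weight
  \<open>x^2 g\<close> together with the explicit growth of \<open>q\<close> and \<open>V\<close>.
  The converse inclusion for the kernel needs the state to lie in the weighted domain; its
  definition only places it in \<open>D0\<close>, and the weight is extracted from its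
  equation.\<close>

lemma AE_lebesgue_on_iff_negligible:
  fixes S :: "real set"
  assumes "S \<in> sets lebesgue"
  shows "(AE x in lebesgue_on S. P x) \<longleftrightarrow> negligible {x \<in> S. \<not> P x}"
proof -
  have "(AE x in lebesgue_on S. P x) \<longleftrightarrow> (AE x in lebesgue. x \<in> S \<longrightarrow> P x)"
    using assms by (simp add: AE_restrict_space_iff)
  also have "\<dots> \<longleftrightarrow> negligible {x \<in> S. \<not> P x}"
    unfolding completion.AE_iff_null_sets negligible_iff_null_sets by simp
  finally show ?thesis .
qed

lemma integrable_lebesgue_on_iff:
  fixes f :: "real \<Rightarrow> 'b::euclidean_space"
  assumes "S \<in> sets lebesgue"
  shows "integrable (lebesgue_on S) f \<longleftrightarrow> f absolutely_integrable_on S"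
  using assms by (simp add: set_integrable_def integrable_restrict_space)

text \<open>Fubini's theorem is applied over \<open>lborel\<close>, whereas absolute integrability
  provides only Lebesgue measurability. The zero extension of \<open>f\<close> agrees almost
  everywhere with a Borel function, found separately for the real and the imaginary part.\<close>

lemma borel_representative:
  fixes f :: "real \<Rightarrow> complex"
  assumes "f absolutely_integrable_on {a..b}"
  obtains g where "integrable lborel g" "AE x in lebesgue. g x = indicator {a..b} x *\<^sub>R f x"
proof -
  let ?f = "\<lambda>x. indicator {a..b} x *\<^sub>R f x"
  have f: "integrable (completion lborel) ?f"
    using assms by (simp add: set_integrable_def)
  then have m: "?f \<in> borel_measurable (completion lborel)"
    by (rule borel_measurable_integrable)
  have "(\<lambda>x. Re (?f x)) \<in> borel_measurable (completion lborel)"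
       "(\<lambda>x. Im (?f x)) \<in> borel_measurable (completion lborel)"
    using m by measurable
  from this[THEN completion_ex_borel_measurable_real]
  obtain r i where r: "r \<in> borel_measurable lborel" "AE x in lborel. Re (?f x) = r x"
    and i: "i \<in> borel_measurable lborel" "AE x in lborel. Im (?f x) = i x"
    by blast
  let ?g = "\<lambda>x. complex_of_real (r x) + \<i> * complex_of_real (i x)"
  have g: "?g \<in> borel_measurable lborel"
    using r(1) i(1) by measurable
  have "AE x in lborel. ?g x = ?f x"
    using r(2) i(2) by eventually_elim (simp add: complex_eq_iff)
  then have ae: "AE x in lebesgue. ?g x = ?f x" by (rule AE_completion)
  have "integrable lebesgue ?g"
    using integrable_cong_AE[OF measurable_completion[OF g] m] f ae by simp
  then have "integrable lborel ?g"
    using integrable_completion[OF g] by simp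
  then show ?thesis using that ae by blast
qed

lemma borel_representative_integral:
  fixes f :: "real \<Rightarrow> complex"
  assumes f: "f absolutely_integrable_on {a..b}" and g: "integrable lborel g"
    and ae: "AE x in lebesgue. g x = indicator {a..b} x *\<^sub>R f x"
    and A: "A \<in> sets borel"
  shows "(LINT y|lborel. indicator A y *\<^sub>R g y) = integral (A \<inter> {a..b}) f"
proof -
  have sub: "f absolutely_integrable_on (A \<inter> {a..b})"
    by (rule set_integrable_subset[OF f]) (use A in auto)
  have m: "(\<lambda>y. indicator A y *\<^sub>R g y) \<in> borel_measurable lborel"
    using g A by measurable
  have "(LINT y|lborel. indicator A y *\<^sub>R g y) = (LINT y|lebesgue. indicator A y *\<^sub>R g y)"
    using integral_completion[OF m] by simp
  also have "\<dots> = (LINT y|lebesgue. indicator (A \<inter> {a..b}) y *\<^sub>R f y)"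
  proof (rule integral_cong_AE)
    show "(\<lambda>y. indicator A y *\<^sub>R g y) \<in> borel_measurable lebesgue"
      using m by (rule measurable_completion)
    show "(\<lambda>y. indicator (A \<inter> {a..b}) y *\<^sub>R f y) \<in> borel_measurable lebesgue"
      using sub unfolding set_integrable_def by (rule borel_measurable_integrable)
    show "AE y in lebesgue. indicator A y *\<^sub>R g y = indicator (A \<inter> {a..b}) y *\<^sub>R f y"
      using ae by eventually_elim (simp add: indicator_inter_arith)
  qed
  also have "\<dots> = integral (A \<inter> {a..b}) f"
    using set_lebesgue_integral_eq_integral(2)[OF sub] by (simp add: set_lebesgue_integral_def)
  finally show ?thesis .
qed

lemma absolutely_integrable_continuous_mult:
  fixes f g :: "real \<Rightarrow> complex"
  assumes "continuous_on {a..b} f" "g absolutely_integrable_on {a..b}"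
  shows "(\<lambda>x. f x * g x) absolutely_integrable_on {a..b}"
  by (rule absolutely_integrable_bounded_measurable_product[OF bilinear_times _ _ _ assms(2)])
    (auto intro!: continuous_imp_measurable_on_sets_lebesgue compact_imp_bounded
       compact_continuous_image assms)

text \<open>\<open>G\<close> is constrained only on \<open>{a..b}\<close>, since \<open>f'\<close>
  vanishes almost everywhere outside; an inner integral over a half-line can therefore play the role
  of \<open>G\<close>.\<close>

lemma borel_representative_mult:
  fixes f g :: "real \<Rightarrow> complex"
  assumes f: "f absolutely_integrable_on {a..b}" and f': "integrable lborel f'"
    and ae: "AE x in lebesgue. f' x = indicator {a..b} x *\<^sub>R f x"
    and g: "g absolutely_integrable_on {a..b}"
    and int: "integrable lborel (\<lambda>x. f' x * G x)"
    and G: "\<And>x. x \<in> {a..b} \<Longrightarrow> G x = integral {a..x} g"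
  shows "(LINT x|lborel. f' x * G x) = integral {a..b} (\<lambda>x. f x * integral {a..x} g)"
proof -
  have "continuous_on {a..b} (\<lambda>x. integral {a..x} g)"
    by (intro indefinite_integral_continuous_1 set_lebesgue_integral_eq_integral(1) g)
  from absolutely_integrable_continuous_mult[OF this f]
  have "(\<lambda>x. f x * integral {a..x} g) absolutely_integrable_on {a..b}"
    by (simp add: mult.commute)
  moreover have "AE x in lebesgue. f' x * G x = indicator {a..b} x *\<^sub>R (f x * integral {a..x} g)"
    using ae by eventually_elim (auto simp: G indicator_def)
  ultimately show ?thesis
    using borel_representative_integral[OF _ int, of a b _ UNIV] by simp
qed

text \<open>Integration by parts in disguise: the left side is the integral of
  \<open>f x * g y\<close> over a square, which is cut along the diagonal. On each triangle one
  integration is carried out first and leaves a primitive.\<close>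

lemma integral_mult_Fubini:
  fixes f g :: "real \<Rightarrow> complex"
  assumes f: "f absolutely_integrable_on {a..b}" and g: "g absolutely_integrable_on {a..b}"
  shows "integral {a..b} f * integral {a..b} g =
     integral {a..b} (\<lambda>x. f x * integral {a..x} g) + integral {a..b} (\<lambda>y. g y * integral {a..y} f)"
proof -
  obtain f' where f': "integrable lborel f'" and aef: "AE x in lebesgue. f' x = indicator {a..b} x *\<^sub>R f x"
    using borel_representative[OF f] .
  obtain g' where g': "integrable lborel g'" and aeg: "AE x in lebesgue. g' x = indicator {a..b} x *\<^sub>R g x"
    using borel_representative[OF g] .
  have [measurable]: "f' \<in> borel_measurable lborel" "g' \<in> borel_measurable lborel"
    using f' g' by auto
  have h: "integrable (lborel \<Otimes>\<^sub>M lborel) (\<lambda>(x,y). f' x * g' y)"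
  proof (rule lborel_pair.Fubini_integrable)
    show "(\<lambda>(x,y). f' x * g' y) \<in> borel_measurable (lborel \<Otimes>\<^sub>M lborel)"
      by measurable
  qed (use f' g' in \<open>auto simp: norm_mult\<close>)
  \<comment> \<open>The diagonal belongs to one triangle only, so that the two indicators add up to
    1 at every point.\<close>
  have h1: "integrable (lborel \<Otimes>\<^sub>M lborel) (\<lambda>(x,y). indicator {..x} y *\<^sub>R (f' x * g' y))"
    by (rule Bochner_Integration.integrable_bound[OF h])
      (auto simp: split_beta' indicator_def of_bool_def)
  have h2: "integrable (lborel \<Otimes>\<^sub>M lborel) (\<lambda>(x,y). indicator {..<y} x *\<^sub>R (f' x * g' y))"
    by (rule Bochner_Integration.integrable_bound[OF h])
      (auto simp: split_beta' indicator_def of_bool_def)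
  have int: "(\<integral>x. f' x \<partial>lborel) = integral {a..b} f" "(\<integral>x. g' x \<partial>lborel) = integral {a..b} g"
    using borel_representative_integral[OF f f' aef, of UNIV]
      borel_representative_integral[OF g g' aeg, of UNIV] by auto
  have "integral {a..b} f * integral {a..b} g = (\<integral>x. \<integral>y. f' x * g' y \<partial>lborel \<partial>lborel)"
    by (simp add: int)
  also have "\<dots> = integral\<^sup>L (lborel \<Otimes>\<^sub>M lborel) (\<lambda>(x,y). f' x * g' y)"
    by (rule lborel_pair.integral_fst[OF h])
  also have "\<dots> = integral\<^sup>L (lborel \<Otimes>\<^sub>M lborel) (\<lambda>p. (case p of (x,y) \<Rightarrow> indicator {..x} y *\<^sub>R (f' x * g' y))
      + (case p of (x,y) \<Rightarrow> indicator {..<y} x *\<^sub>R (f' x * g' y)))"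
    by (rule Bochner_Integration.integral_cong) (auto simp: indicator_def)
  also have "\<dots> = integral\<^sup>L (lborel \<Otimes>\<^sub>M lborel) (\<lambda>(x,y). indicator {..x} y *\<^sub>R (f' x * g' y))
      + integral\<^sup>L (lborel \<Otimes>\<^sub>M lborel) (\<lambda>(x,y). indicator {..<y} x *\<^sub>R (f' x * g' y))"
    by (rule Bochner_Integration.integral_add[OF h1 h2])
  also have "\<dots> = (\<integral>x. \<integral>y. indicator {..x} y *\<^sub>R (f' x * g' y) \<partial>lborel \<partial>lborel)
      + (\<integral>y. \<integral>x. indicator {..<y} x *\<^sub>R (f' x * g' y) \<partial>lborel \<partial>lborel)"
    by (simp only: lborel_pair.integral_fst[OF h1] lborel_pair.integral_snd[OF h2])
  also have "(\<integral>x. \<integral>y. indicator {..x} y *\<^sub>R (f' x * g' y) \<partial>lborel \<partial>lborel) =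
      (\<integral>x. f' x * (\<integral>y. indicator {..x} y *\<^sub>R g' y \<partial>lborel) \<partial>lborel)"
    by (simp flip: integral_mult_right_zero)
  also have "(\<integral>y. \<integral>x. indicator {..<y} x *\<^sub>R (f' x * g' y) \<partial>lborel \<partial>lborel) =
      (\<integral>y. g' y * (\<integral>x. indicator {..<y} x *\<^sub>R f' x \<partial>lborel) \<partial>lborel)"
    by (simp add: mult.commute flip: integral_mult_right_zero)
  also have "(\<integral>x. f' x * (\<integral>y. indicator {..x} y *\<^sub>R g' y \<partial>lborel) \<partial>lborel) =
     integral {a..b} (\<lambda>x. f x * integral {a..x} g)"
  proof (rule borel_representative_mult[OF f f' aef g])
    show "integrable lborel (\<lambda>x. f' x * (\<integral>y. indicator {..x} y *\<^sub>R g' y \<partial>lborel))"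
      using lborel_pair.integrable_fst[OF h1] by (simp flip: integral_mult_right_zero)
    show "(\<integral>y. indicator {..x} y *\<^sub>R g' y \<partial>lborel) = integral {a..x} g" if "x \<in> {a..b}" for x
    proof -
      have *: "{..x} \<inter> {a..b} = {a..x}" using that by auto
      show ?thesis using borel_representative_integral[OF g g' aeg, of "{..x}"] by (simp only: * borel_closed closed_atMost)
    qed
  qed
  also have "(\<integral>y. g' y * (\<integral>x. indicator {..<y} x *\<^sub>R f' x \<partial>lborel) \<partial>lborel) =
     integral {a..b} (\<lambda>y. g y * integral {a..y} f)"
  proof (rule borel_representative_mult[OF g g' aeg f])
    show "integrable lborel (\<lambda>y. g' y * (\<integral>x. indicator {..<y} x *\<^sub>R f' x \<partial>lborel))"
      using lborel_pair.integrable_snd[OF h2] by (simp add: mult.commute flip: integral_mult_right_zero)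
    show "(\<integral>x. indicator {..<y} x *\<^sub>R f' x \<partial>lborel) = integral {a..y} f" if "y \<in> {a..b}" for y
    proof -
      have *: "{..<y} \<inter> {a..b} = {a..<y}" using that by auto
      \<comment> \<open>The strict triangle omits the endpoint \<open>y\<close>, a null set.\<close>
      have "integral {a..<y} f = integral {a..y} f"
        by (rule integral_spike_set) (auto intro: negligible_subset[of "{y}"])
      then show ?thesis using borel_representative_integral[OF f f' aef, of "{..<y}"] by (simp add: *)
    qed
  qed
  finally show ?thesis .
qed

section \<open>Primitives of integrable functions\<close>

text \<open>
  Absolute continuity with given derivative, in integral form: \<open>F\<close> need not be differentiable
  anywhere, so the product rule below rests on Fubini's theorem.
\<close>

definition primitive_on :: "real set \<Rightarrow> (real \<Rightarrow> complex) \<Rightarrow> (real \<Rightarrow> complex) \<Rightarrow> bool" where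
  "primitive_on S F f \<longleftrightarrow> (\<forall>a\<in>S. \<forall>b\<in>S. a \<le> b \<longrightarrow>
     f absolutely_integrable_on {a..b} \<and> F b - F a = integral {a..b} f)"

lemma primitive_onD:
  assumes "primitive_on S F f" "a \<in> S" "b \<in> S" "a \<le> b"
  shows "f absolutely_integrable_on {a..b}" "F b = F a + integral {a..b} f"
proof -
  have "f absolutely_integrable_on {a..b} \<and> F b - F a = integral {a..b} f"
    using assms unfolding primitive_on_def by blast
  then show "f absolutely_integrable_on {a..b}" "F b = F a + integral {a..b} f"
    by (auto simp: algebra_simps)
qed

lemma interval_Icc_subset:
  fixes S :: "real set"
  assumes "is_interval S" "a \<in> S" "b \<in> S"
  shows "{a..b} \<subseteq> S"
  using mem_is_interval_1_I[OF assms] by auto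

lemma primitive_on_cong_AE:
  assumes F: "primitive_on S F f" and S: "is_interval S"
    and ae: "negligible {x \<in> S. f x \<noteq> g x}" and eq: "\<And>x. x \<in> S \<Longrightarrow> F x = G x"
  shows "primitive_on S G g"
  unfolding primitive_on_def
proof (intro ballI impI)
  fix a b assume ab: "a \<in> S" "b \<in> S" "a \<le> b"
  have sub: "{a..b} \<subseteq> S" using interval_Icc_subset[OF S] ab by blast
  have "g absolutely_integrable_on {a..b}"
    by (rule absolutely_integrable_spike[OF primitive_onD(1)[OF F ab] ae]) (use sub in auto)
  moreover have "integral {a..b} g = integral {a..b} f"
    by (rule integral_spike[OF ae]) (use sub in auto)
  ultimately show "g absolutely_integrable_on {a..b} \<and> G b - G a = integral {a..b} g"
    using primitive_onD(2)[OF F ab] eq ab by simp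
qed

text \<open>Primitives are controlled through integrals over compact intervals with a fixed left
  end, while continuity and derivatives refer to all of \<open>S\<close>. Near \<open>x\<close> both
  give the same filter; if \<open>x\<close> is an end of \<open>S\<close>, the compact interval
  starts or stops at \<open>x\<close>.\<close>

lemma interval_at_within_Icc:
  fixes S :: "real set"
  assumes S: "is_interval S" and x: "x \<in> S"
  obtains a b where "a \<in> S" "b \<in> S" "a \<le> x" "x \<le> b" "at x within S = at x within {a..b}"
proof -
  \<comment> \<open>To the right of \<open>l\<close>, no point of \<open>S\<close> lies below
    \<open>a\<close>. If \<open>S\<close> has no points left of \<open>x\<close>, then
    \<open>a = x\<close> works with any \<open>l\<close> below \<open>x\<close>.\<close>
  obtain a l where a: "a \<in> S" "a \<le> x" "l < x" "\<And>y. y \<in> S \<Longrightarrow> l < y \<Longrightarrow> a \<le> y"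
  proof (cases "\<exists>a\<in>S. a < x")
    case True
    then obtain a where "a \<in> S" "a < x" by blast
    then show ?thesis by (intro that[of a a]) auto
  next
    case False
    then show ?thesis using x by (intro that[of x "x - 1"]) auto
  qed
  obtain b u where b: "b \<in> S" "x \<le> b" "x < u" "\<And>y. y \<in> S \<Longrightarrow> y < u \<Longrightarrow> y \<le> b"
  proof (cases "\<exists>b\<in>S. x < b")
    case True
    then obtain b where "b \<in> S" "x < b" by blast
    then show ?thesis by (intro that[of b b]) auto
  next
    case False
    then show ?thesis using x by (intro that[of x "x + 1"]) auto
  qed
  have "at x within S = at x within {a..b}"
  proof (rule at_within_nhd)
    show "x \<in> {l<..<u}" using a b by auto
    show "S \<inter> {l<..<u} - {x} = {a..b} \<inter> {l<..<u} - {x}"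
      using a b interval_Icc_subset[OF S a(1) b(1)] by auto
  qed simp
  then show ?thesis using that a b by blast
qed

lemma primitive_on_continuous_on:
  assumes F: "primitive_on S F f" and S: "is_interval S"
  shows "continuous_on S F"
  unfolding continuous_on_eq_continuous_within
proof
  fix x assume x: "x \<in> S"
  obtain a b where ab: "a \<in> S" "b \<in> S" "a \<le> x" "x \<le> b" and at: "at x within S = at x within {a..b}"
    using interval_at_within_Icc[OF S x] .
  have sub: "{a..b} \<subseteq> S" using interval_Icc_subset[OF S] ab by blast
  have "f absolutely_integrable_on {a..b}" using primitive_onD(1)[OF F, of a b] ab by auto
  then have "continuous_on {a..b} (\<lambda>y. F a + integral {a..y} f)"
    by (intro continuous_intros indefinite_integral_continuous_1 set_lebesgue_integral_eq_integral(1))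
  moreover have "F a + integral {a..y} f = F y" if "y \<in> {a..b}" for y
    using primitive_onD(2)[OF F ab(1), of y] sub that by auto
  ultimately have "continuous_on {a..b} F"
    by (rule continuous_on_eq)
  then show "continuous (at x within S) F"
    unfolding at using ab by (simp add: continuous_on_eq_continuous_within)
qed

lemma primitive_on_has_vector_derivative:
  assumes F: "primitive_on S F f" and S: "is_interval S" and f: "continuous_on S f" and x: "x \<in> S"
  shows "(F has_vector_derivative f x) (at x within S)"
proof -
  obtain a b where ab: "a \<in> S" "b \<in> S" "a \<le> x" "x \<le> b" and at: "at x within S = at x within {a..b}"
    using interval_at_within_Icc[OF S x] .
  have sub: "{a..b} \<subseteq> S" using interval_Icc_subset[OF S] ab by blast
  have "((\<lambda>y. integral {a..y} f) has_vector_derivative f x) (at x within {a..b})"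
    by (rule integral_has_vector_derivative) (use ab continuous_on_subset[OF f sub] in auto)
  then have "((\<lambda>y. F a + integral {a..y} f) has_vector_derivative f x) (at x within {a..b})"
    by (auto intro!: derivative_eq_intros)
  moreover have "F y = F a + integral {a..y} f" if "y \<in> {a..b}" for y
    using primitive_onD(2)[OF F ab(1), of y] sub that by auto
  moreover have "x \<in> {a..b}" using ab by simp
  ultimately show ?thesis
    unfolding at by (intro has_vector_derivative_transform[of x "{a..b}" F "\<lambda>y. F a + integral {a..y} f"])
qed

lemma has_vector_derivative_primitive_on:
  assumes F: "\<And>x. x \<in> S \<Longrightarrow> (F has_vector_derivative f x) (at x within S)" and S: "is_interval S"
    and f: "continuous_on S f"
  shows "primitive_on S F f"
  unfolding primitive_on_def
proof (intro ballI impI conjI)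
  fix a b assume ab: "a \<in> S" "b \<in> S" "a \<le> b"
  have sub: "{a..b} \<subseteq> S" using interval_Icc_subset[OF S] ab by blast
  show "f absolutely_integrable_on {a..b}"
    using continuous_on_subset[OF f sub] by (rule absolutely_integrable_continuous_real)
  have "(f has_integral F b - F a) {a..b}"
    by (rule fundamental_theorem_of_calculus)
      (use ab sub has_vector_derivative_within_subset[OF F sub] in auto)
  then show "F b - F a = integral {a..b} f" by (simp add: integral_unique)
qed

text \<open>With \<open>F\<close> and \<open>G\<close> written as initial value plus indefinite
  integral, the increment of their product is a product of two integrals plus two linear terms.
  Fubini expands the product, and the initial values it brings in cancel the linear terms.\<close>

lemma primitive_on_mult:
  assumes F: "primitive_on S F f" and G: "primitive_on S G g" and S: "is_interval S"
  shows "primitive_on S (\<lambda>x. F x * G x) (\<lambda>x. f x * G x + F x * g x)"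
  unfolding primitive_on_def
proof (intro ballI impI)
  fix a b assume ab: "a \<in> S" "b \<in> S" "a \<le> b"
  have sub: "{a..b} \<subseteq> S" using interval_Icc_subset[OF S] ab by blast
  note f = primitive_onD(1)[OF F ab] and g = primitive_onD(1)[OF G ab]
  have cont: "continuous_on {a..b} F" "continuous_on {a..b} G"
    using primitive_on_continuous_on[OF F S] primitive_on_continuous_on[OF G S] sub continuous_on_subset by blast+
  have fG: "(\<lambda>x. f x * G x) absolutely_integrable_on {a..b}"
    using absolutely_integrable_continuous_mult[OF cont(2) f] by (simp add: mult.commute)
  have Fg: "(\<lambda>x. F x * g x) absolutely_integrable_on {a..b}"
    by (rule absolutely_integrable_continuous_mult[OF cont(1) g])
  have int: "f integrable_on {a..b}" "g integrable_on {a..b}"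
     "(\<lambda>x. f x * G x) integrable_on {a..b}" "(\<lambda>x. F x * g x) integrable_on {a..b}"
    using f g fG Fg set_lebesgue_integral_eq_integral(1) by blast+
  have eqs: "integral {a..x} f = F x - F a" "integral {a..x} g = G x - G a" if "x \<in> {a..b}" for x
    using primitive_onD(2)[OF F ab(1), of x] primitive_onD(2)[OF G ab(1), of x] sub that by auto
  have "integral {a..b} (\<lambda>x. f x * integral {a..x} g) = integral {a..b} (\<lambda>x. f x * G x - f x * G a)"
    by (rule Henstock_Kurzweil_Integration.integral_cong) (simp add: eqs algebra_simps)
  also have "\<dots> = integral {a..b} (\<lambda>x. f x * G x) - integral {a..b} f * G a"
    by (simp add: Henstock_Kurzweil_Integration.integral_diff int integrable_on_mult_left)
  finally have 1: "integral {a..b} (\<lambda>x. f x * integral {a..x} g) = \<dots>" .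
  have "integral {a..b} (\<lambda>x. g x * integral {a..x} f) = integral {a..b} (\<lambda>x. F x * g x - g x * F a)"
    by (rule Henstock_Kurzweil_Integration.integral_cong) (simp add: eqs algebra_simps)
  also have "\<dots> = integral {a..b} (\<lambda>x. F x * g x) - integral {a..b} g * F a"
    by (simp add: Henstock_Kurzweil_Integration.integral_diff int integrable_on_mult_left)
  finally have 2: "integral {a..b} (\<lambda>x. g x * integral {a..x} f) = \<dots>" .
  have "F b * G b - F a * G a = integral {a..b} f * integral {a..b} g
      + integral {a..b} f * G a + integral {a..b} g * F a"
    using ab by (simp add: eqs algebra_simps)
  also have "\<dots> = integral {a..b} (\<lambda>x. f x * G x) + integral {a..b} (\<lambda>x. F x * g x)"
    unfolding integral_mult_Fubini[OF f g] 1 2 by simp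
  also have "\<dots> = integral {a..b} (\<lambda>x. f x * G x + F x * g x)"
    using int by (simp add: Henstock_Kurzweil_Integration.integral_add)
  finally show "(\<lambda>x. f x * G x + F x * g x) absolutely_integrable_on {a..b} \<and>
      F b * G b - F a * G a = integral {a..b} (\<lambda>x. f x * G x + F x * g x)"
    using set_integral_add(1)[OF fG Fg] by simp
qed

lemma primitive_on_add:
  assumes "primitive_on S F f" "primitive_on S G g"
  shows "primitive_on S (\<lambda>x. F x + G x) (\<lambda>x. f x + g x)"
  unfolding primitive_on_def
proof (intro ballI impI conjI)
  fix a b assume ab: "a \<in> S" "b \<in> S" "a \<le> b"
  note f = primitive_onD(1)[OF assms(1) ab] and g = primitive_onD(1)[OF assms(2) ab]
  show "(\<lambda>x. f x + g x) absolutely_integrable_on {a..b}"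
    using f g by (rule set_integral_add(1))
  have "f integrable_on {a..b}" "g integrable_on {a..b}"
    using f g set_lebesgue_integral_eq_integral(1) by blast+
  then have "integral {a..b} (\<lambda>x. f x + g x) = integral {a..b} f + integral {a..b} g"
    by (rule Henstock_Kurzweil_Integration.integral_add)
  also have "integral {a..b} f = F b - F a"
    unfolding primitive_onD(2)[OF assms(1) ab] by simp
  also have "integral {a..b} g = G b - G a"
    unfolding primitive_onD(2)[OF assms(2) ab] by simp
  finally show "F b + G b - (F a + G a) = integral {a..b} (\<lambda>x. f x + g x)"
    by simp
qed

lemma primitive_on_bounded_linear:
  assumes F: "primitive_on S F f" and h: "bounded_linear h"
  shows "primitive_on S (\<lambda>x. h (F x)) (\<lambda>x. h (f x))"
  unfolding primitive_on_def
proof (intro ballI impI conjI)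
  fix a b assume ab: "a \<in> S" "b \<in> S" "a \<le> b"
  note f = primitive_onD(1)[OF F ab]
  show "(\<lambda>x. h (f x)) absolutely_integrable_on {a..b}"
    using absolutely_integrable_linear[OF f h] by (simp add: o_def)
  have "integral {a..b} (\<lambda>x. h (f x)) = h (integral {a..b} f)"
    using integral_linear[OF set_lebesgue_integral_eq_integral(1)[OF f] h] by (simp add: o_def)
  also have "\<dots> = h (F b) - h (F a)"
    unfolding primitive_onD(2)[OF F ab] linear_add[OF bounded_linear.linear[OF h]] by simp
  finally show "h (F b) - h (F a) = integral {a..b} (\<lambda>x. h (f x))" ..
qed

section \<open>The lemma of du Bois-Reymond\<close>

text \<open>All integrals of \<open>f\<close> over subintervals vanish, so Lebesgue differentiation
  gives zero almost everywhere. The argument is local because integrability is known only on compact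
  subintervals of \<open>I\<close>.\<close>

lemma primitive_on_constant_imp_AE_zero:
  assumes I: "open I" "is_interval I" and f: "primitive_on I (\<lambda>_. C) f"
  shows "negligible {x \<in> I. f x \<noteq> 0}"
  unfolding locally_negligible_alt[of "{x \<in> I. f x \<noteq> 0}"]
proof
  fix x assume "x \<in> {x \<in> I. f x \<noteq> 0}"
  then obtain e where e: "e > 0" "cball x e \<subseteq> I" and x: "x \<in> I" "f x \<noteq> 0"
    using I(1) open_contains_cball by blast
  define a b where "a = x - e" and "b = x + e"
  have ab: "a \<le> b" "{a..b} \<subseteq> I" "x \<in> {a<..<b}"
    using e by (auto simp: a_def b_def cball_eq_atLeastAtMost)
  have zero: "integral {s..t} f = 0" if "a \<le> s" "s \<le> t" "t \<le> b" for s t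
  proof -
    have "s \<in> {a..b}" "t \<in> {a..b}" using that by auto
    then have "s \<in> I" "t \<in> I" using ab by blast+
    then show ?thesis using primitive_onD(2)[OF f, of s t] that by simp
  qed
  define g where "g = (\<lambda>x. if x \<in> {a..b} then f x else 0)"
  have "f integrable_on {a..b}"
    using primitive_onD(1)[OF f, of a b] ab set_lebesgue_integral_eq_integral(1) by (metis atLeastAtMost_iff order_refl subsetD)
  then have "g integrable_on UNIV"
    unfolding g_def by (subst integrable_restrict_UNIV)
  then have "g integrable_on cbox c d" for c d
    by (rule integrable_on_subcbox) simp
  then obtain N where N: "negligible N"
    "\<And>x e. \<lbrakk>x \<notin> N; 0 < e\<rbrakk> \<Longrightarrow> \<exists>d>0. \<forall>h. 0 < h \<and> h < d \<longrightarrow>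
        norm (integral (cbox x (x + h *\<^sub>R One)) g /\<^sub>R h ^ DIM(real) - g x) < e"
    using integrable_ccontinuous_explicit[of g] by blast
  have "f y = 0" if y: "y \<in> {a<..<b}" "y \<notin> N" for y
  proof (rule ccontr)
    assume "f y \<noteq> 0"
    then obtain d where d: "d > 0" "\<forall>h. 0 < h \<and> h < d \<longrightarrow>
        norm (integral (cbox y (y + h *\<^sub>R One)) g /\<^sub>R h ^ DIM(real) - g y) < norm (f y)"
      using N(2)[OF y(2), of "norm (f y)"] by auto
    \<comment> \<open>The increment stays below \<open>d\<close> and keeps \<open>y + h\<close>
      within \<open>{a..b}\<close>, beyond which \<open>g\<close> is cut off to zero.\<close>
    define h where "h = min (d/2) (b - y)"
    have h: "0 < h" "h < d" "y + h \<le> b" using d y by (auto simp: h_def)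
    have "integral {y..y+h} g = integral {y..y+h} f"
      by (rule Henstock_Kurzweil_Integration.integral_cong) (use h y in \<open>auto simp: g_def\<close>)
    also have "\<dots> = 0" using zero[of y "y+h"] h y by auto
    finally have "norm (g y) < norm (f y)" using d(2) h by auto
    then show False using y by (auto simp: g_def)
  qed
  then have "negligible ({x \<in> I. f x \<noteq> 0} \<inter> {a<..<b})"
    by (intro negligible_subset[OF N(1)] subsetI) (metis (mono_tags, lifting) IntE mem_Collect_eq)
  then show "\<exists>U. openin (top_of_set {x \<in> I. f x \<noteq> 0}) U \<and> x \<in> U \<and> negligible U"
    using x ab by (intro exI[of _ "{x \<in> I. f x \<noteq> 0} \<inter> {a<..<b}"]) (auto simp: openin_open)
qed

text \<open>Derivatives of test functions are continuous, so an indicator function cannot be tested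
  with directly. This replaces the indicator of \<open>{s<..<t}\<close> by a function with ramps of
  slope \<open>n\<close>, placed inside the interval so that the support never leaves
  \<open>{s..t}\<close>.\<close>

definition trapezoid :: "real \<Rightarrow> real \<Rightarrow> nat \<Rightarrow> real \<Rightarrow> real" where
  "trapezoid s t n x = max 0 (min 1 (real n * min (x - s) (t - x)))"

lemma continuous_on_trapezoid: "continuous_on A (trapezoid s t n)"
  unfolding trapezoid_def by (intro continuous_intros)

lemma trapezoid_bounds: "0 \<le> trapezoid s t n x" "trapezoid s t n x \<le> 1"
  by (auto simp: trapezoid_def)

lemma trapezoid_outside:
  assumes "x \<notin> {s<..<t}"
  shows "trapezoid s t n x = 0"
proof -
  have "min (x - s) (t - x) \<le> 0" using assms by auto
  then have "real n * min (x - s) (t - x) \<le> 0" by (intro mult_nonneg_nonpos) auto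
  then show ?thesis unfolding trapezoid_def by linarith
qed

lemma trapezoid_tendsto_indicator: "(\<lambda>n. trapezoid s t n x) \<longlonglongrightarrow> indicator {s<..<t} x"
proof (cases "x \<in> {s<..<t}")
  case True
  then have "min (x - s) (t - x) > 0" by simp
  then obtain N where N: "1 < real N * min (x - s) (t - x)"
    using reals_Archimedean3 by blast
  have "trapezoid s t n x = 1" if "n \<ge> N" for n
  proof -
    have "real N * min (x - s) (t - x) \<le> real n * min (x - s) (t - x)"
      using that True by (intro mult_right_mono) auto
    then show ?thesis unfolding trapezoid_def using N by (intro antisym) linarith+
  qed
  then have "eventually (\<lambda>n. trapezoid s t n x = indicator {s<..<t} x) sequentially"
    using True unfolding eventually_sequentially by auto
  then show ?thesis by (rule tendsto_eventually)
qed (simp add: trapezoid_outside)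

lemma trapezoid_integral_tendsto:
  fixes u :: "real \<Rightarrow> 'b::euclidean_space"
  assumes u: "u absolutely_integrable_on {a..b}" and "{s..t} \<subseteq> {a..b}"
  shows "(\<lambda>x. trapezoid s t n x *\<^sub>R u x) absolutely_integrable_on {a..b}"
    and "(\<lambda>n. integral {a..b} (\<lambda>x. trapezoid s t n x *\<^sub>R u x)) \<longlonglongrightarrow> integral {s..t} u"
proof -
  have bil: "bilinear (\<lambda>(x::real) (y::'b). x *\<^sub>R y)"
    using bilinear_conv_bounded_bilinear bounded_bilinear_scaleR by blast
  show abs: "(\<lambda>x. trapezoid s t n x *\<^sub>R u x) absolutely_integrable_on {a..b}" for n
    by (rule absolutely_integrable_bounded_measurable_product[OF bil _ _ _ u])
      (auto intro!: continuous_imp_measurable_on_sets_lebesgue continuous_on_trapezoid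
         compact_imp_bounded compact_continuous_image)
  have "(\<lambda>n. integral {a..b} (\<lambda>x. trapezoid s t n x *\<^sub>R u x)) \<longlonglongrightarrow>
      integral {a..b} (\<lambda>x. indicator {s<..<t} x *\<^sub>R u x)"
  proof (rule dominated_convergence)
    show "(\<lambda>x. trapezoid s t n x *\<^sub>R u x) integrable_on {a..b}" for n
      using abs by (rule set_lebesgue_integral_eq_integral(1))
    show "(\<lambda>x. norm (u x)) integrable_on {a..b}"
      using u absolutely_integrable_on_def by blast
    show "norm (trapezoid s t n x *\<^sub>R u x) \<le> norm (u x)" for n x
      using trapezoid_bounds[of s t n x] by (simp add: mult_left_le_one_le)
    show "(\<lambda>n. trapezoid s t n x *\<^sub>R u x) \<longlonglongrightarrow> indicator {s<..<t} x *\<^sub>R u x" for x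
      by (intro tendsto_intros trapezoid_tendsto_indicator)
  qed
  also have "integral {a..b} (\<lambda>x. indicator {s<..<t} x *\<^sub>R u x) = integral ({s<..<t} \<inter> {a..b}) u"
    by (simp add: integral_restrict_Int[symmetric] indicator_scaleR_eq_if)
  also have "\<dots> = integral {s..t} u"
    by (rule integral_spike_set) (use assms in \<open>auto intro: negligible_subset[of "{s,t}"]\<close>)
  finally show "(\<lambda>n. integral {a..b} (\<lambda>x. trapezoid s t n x *\<^sub>R u x)) \<longlonglongrightarrow> integral {s..t} u" .
qed

lemma integral_lebesgue_on_supported:
  fixes f :: "real \<Rightarrow> complex"
  assumes "I \<in> sets lebesgue" "{a..b} \<subseteq> I" and f: "f absolutely_integrable_on {a..b}"
    and 0: "\<And>x. x \<in> I \<Longrightarrow> x \<notin> {a..b} \<Longrightarrow> f x = 0"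
  shows "integrable (lebesgue_on I) f" "(LINT x|lebesgue_on I. f x) = integral {a..b} f"
proof -
  have "f absolutely_integrable_on I"
    by (rule absolutely_integrable_spike_set[OF f]) (use assms in \<open>auto intro!: empty_imp_negligible\<close>)
  then show i: "integrable (lebesgue_on I) f"
    using assms by (simp add: integrable_lebesgue_on_iff)
  have "(LINT x|lebesgue_on I. f x) = integral I f"
    by (rule lebesgue_integral_eq_integral[OF i assms(1)])
  also have "\<dots> = integral {a..b} f"
    by (rule integral_spike_set) (use assms in \<open>auto intro!: empty_imp_negligible\<close>)
  finally show "(LINT x|lebesgue_on I. f x) = integral {a..b} f" .
qed

text \<open>Zero mean is the only obstruction: the primitive starting at \<open>a\<close> then
  returns to zero at \<open>b\<close> and stays there, which gives compact support.\<close>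

lemma test_function_primitive:
  fixes w :: "real \<Rightarrow> real"
  assumes "{a..b} \<subseteq> I" and w: "continuous_on UNIV w" and 0: "\<And>x. x \<notin> {a..b} \<Longrightarrow> w x = 0"
    and int: "integral {a..b} w = 0" and ab: "a \<le> b"
  obtains \<eta> where "test_function I \<eta>" "\<And>x. deriv \<eta> x = w x"
proof
  define \<eta> where "\<eta> = (\<lambda>x. integral {a..x} w)"
  have w': "w integrable_on {c..d}" for c d
    using w by (intro integrable_continuous_real) (auto intro: continuous_on_subset)
  have eq: "\<eta> y = integral {l..y} w" if "l \<le> a" "l \<le> y" for l y
  proof (cases "a \<le> y")
    case True
    have "integral {l..a} w = integral {l..a} (\<lambda>_. 0)"
      by (rule integral_spike[of "{a}"]) (use 0 in auto)
    then show ?thesis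
      using Henstock_Kurzweil_Integration.integral_combine[of l a y w] True that w' by (simp add: \<eta>_def)
  next
    case False
    have "integral {l..y} w = integral {l..y} (\<lambda>_. 0)"
      by (rule Henstock_Kurzweil_Integration.integral_cong) (use 0 False in auto)
    then show ?thesis using False by (simp add: \<eta>_def)
  qed
  have deriv: "(\<eta> has_real_derivative w x) (at x)" for x
  proof -
    \<comment> \<open>A base point strictly left of both \<open>a\<close> and \<open>x\<close> makes
      \<open>x\<close> interior to the interval of integration; the primitive is unchanged because
      \<open>w\<close> vanishes left of \<open>a\<close>.\<close>
    define l where "l = min a x - 1"
    have "((\<lambda>y. integral {l..y} w) has_real_derivative w x) (at x within {l..x+1})"
      by (rule integral_has_real_derivative) (auto intro: continuous_on_subset[OF w] simp: l_def)
    then have "((\<lambda>y. integral {l..y} w) has_real_derivative w x) (at x)"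
      by (subst (asm) at_within_Icc_at) (auto simp: l_def)
    moreover have "eventually (\<lambda>y. integral {l..y} w = \<eta> y) (nhds x)"
    proof (rule eventually_mono)
      show "eventually (\<lambda>y. y \<in> {l<..}) (nhds x)"
        by (rule eventually_nhds_in_open) (auto simp: l_def)
      show "integral {l..y} w = \<eta> y" if "y \<in> {l<..}" for y
        using eq[of l y] that by (auto simp: l_def)
    qed
    ultimately show ?thesis by (subst (asm) DERIV_cong_ev) auto
  qed
  then show d: "deriv \<eta> x = w x" for x by (rule DERIV_imp_deriv)
  have "\<eta> x = 0" if "x \<notin> {a..b}" for x
  proof (cases "x < a")
    case False
    then have x: "b \<le> x" using that by auto
    have "integral {b..x} w = integral {b..x} (\<lambda>_. 0)"
      by (rule integral_spike[of "{b}"]) (use 0 in auto)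
    then show ?thesis
      using Henstock_Kurzweil_Integration.integral_combine[of a b x w] x ab w' int by (simp add: \<eta>_def)
  qed (simp add: \<eta>_def)
  moreover have "\<eta> differentiable_on UNIV"
    using deriv by (meson differentiable_at_withinI differentiable_on_def real_differentiable_def)
  ultimately show "test_function I \<eta>"
    unfolding test_function_def using assms(1) w d by (auto intro!: exI[of _ "{a..b}"])
qed

text \<open>A suitable combination of two trapezoids has mean zero and hence is an admissible
  derivative. In the limit \<open>u\<close> has the same average over any two subintervals, so
  \<open>u\<close> minus one fixed average integrates to zero over every subinterval, and Lebesgue
  differentiation finishes the proof.\<close>

lemma du_Bois_Reymond:
  fixes u :: "real \<Rightarrow> complex"
  assumes I: "open I" "is_interval I" "I \<noteq> {}"
    and u: "\<And>a b. a \<in> I \<Longrightarrow> b \<in> I \<Longrightarrow> u absolutely_integrable_on {a..b}"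
    and 0: "\<And>\<eta>. test_function I \<eta> \<Longrightarrow> (LINT x|lebesgue_on I. deriv \<eta> x *\<^sub>R u x) = 0"
  obtains C where "negligible {x \<in> I. u x \<noteq> C}"
proof -
  have meas: "I \<in> sets lebesgue" using I(1) by simp
  \<comment> \<open>Equality of averages, multiplied out so that degenerate intervals are covered as
    well.\<close>
  have average: "(q - p) *\<^sub>R integral {s..t} u = (t - s) *\<^sub>R integral {p..q} u"
    if I4: "s \<in> I" "t \<in> I" "p \<in> I" "q \<in> I" and le: "s \<le> t" "p \<le> q" for s t p q
  proof -
    define a b where "a = min s p" and "b = max t q"
    have ab: "a \<in> I" "b \<in> I" "a \<le> b" "{s..t} \<subseteq> {a..b}" "{p..q} \<subseteq> {a..b}"
      using that by (auto simp: a_def b_def min_def max_def)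
    have sub: "{a..b} \<subseteq> I" by (rule interval_Icc_subset[OF I(2) ab(1,2)])
    note u' = u[OF ab(1,2)]
    have one: "(\<lambda>_. 1::real) absolutely_integrable_on {a..b}"
      by (rule absolutely_integrable_continuous_real) auto
    define m where "m = (\<lambda>n s t. integral {a..b} (trapezoid s t n))"
    define J where "J = (\<lambda>n s t. integral {a..b} (\<lambda>x. trapezoid s t n x *\<^sub>R u x))"
    have eq: "m n p q *\<^sub>R J n s t = m n s t *\<^sub>R J n p q" for n
    proof -
      \<comment> \<open>Each trapezoid is weighted with the mass of the other one, which makes the
        mean of \<open>w\<close> vanish.\<close>
      define w where "w = (\<lambda>x. m n p q * trapezoid s t n x - m n s t * trapezoid p q n x)"
      have int: "trapezoid s t n integrable_on {a..b}" for s t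
        by (intro integrable_continuous_real continuous_on_trapezoid)
      have "integral {a..b} w = 0"
        unfolding w_def using int
        by (subst Henstock_Kurzweil_Integration.integral_diff)
          (auto intro: integrable_on_mult_right simp: m_def)
      moreover have "continuous_on UNIV w"
        unfolding w_def by (intro continuous_intros continuous_on_trapezoid)
      moreover have "w x = 0" if "x \<notin> {a..b}" for x
      proof -
        have "x \<notin> {s<..<t}" "x \<notin> {p<..<q}" using that by (auto simp: a_def b_def)
        then show ?thesis by (simp add: w_def trapezoid_outside)
      qed
      ultimately obtain \<eta> where \<eta>: "test_function I \<eta>" "\<And>x. deriv \<eta> x = w x"
        using test_function_primitive[OF sub] ab(3) by blast
      have i: "(\<lambda>x. trapezoid s t n x *\<^sub>R u x) absolutely_integrable_on {a..b}"
              "(\<lambda>x. trapezoid p q n x *\<^sub>R u x) absolutely_integrable_on {a..b}"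
        using trapezoid_integral_tendsto(1)[OF u'] ab by blast+
      have eq: "(\<lambda>x. w x *\<^sub>R u x) = (\<lambda>x. m n p q *\<^sub>R (trapezoid s t n x *\<^sub>R u x) - m n s t *\<^sub>R (trapezoid p q n x *\<^sub>R u x))"
        by (auto simp: w_def scaleR_diff_left)
      have "(\<lambda>x. w x *\<^sub>R u x) absolutely_integrable_on {a..b}"
        unfolding eq using i by (intro set_integral_diff absolutely_integrable_scaleR_left) auto
      then have "(LINT x|lebesgue_on I. w x *\<^sub>R u x) = integral {a..b} (\<lambda>x. w x *\<^sub>R u x)"
        by (rule integral_lebesgue_on_supported(2)[OF meas sub]) (use \<open>\<And>x. x \<notin> {a..b} \<Longrightarrow> w x = 0\<close> in auto)
      also have "\<dots> = m n p q *\<^sub>R J n s t - m n s t *\<^sub>R J n p q"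
        unfolding eq J_def using i[THEN set_lebesgue_integral_eq_integral(1)]
        by (subst Henstock_Kurzweil_Integration.integral_diff) (auto intro: integrable_cmul simp del: scaleR_scaleR)
      finally show ?thesis using 0[OF \<eta>(1)] \<eta>(2) by simp
    qed
    have m: "(\<lambda>n. m n s t) \<longlonglongrightarrow> t - s" "(\<lambda>n. m n p q) \<longlonglongrightarrow> q - p"
      using trapezoid_integral_tendsto(2)[OF one ab(4)] trapezoid_integral_tendsto(2)[OF one ab(5)] le
      by (simp_all add: m_def)
    have J: "(\<lambda>n. J n s t) \<longlonglongrightarrow> integral {s..t} u" "(\<lambda>n. J n p q) \<longlonglongrightarrow> integral {p..q} u"
      unfolding J_def using trapezoid_integral_tendsto(2)[OF u'] ab by simp_all
    have "(\<lambda>n. m n p q *\<^sub>R J n s t) \<longlonglongrightarrow> (q - p) *\<^sub>R integral {s..t} u"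
      by (rule tendsto_scaleR[OF m(2) J(1)])
    moreover have "(\<lambda>n. m n p q *\<^sub>R J n s t) \<longlonglongrightarrow> (t - s) *\<^sub>R integral {p..q} u"
      unfolding eq by (rule tendsto_scaleR[OF m(1) J(2)])
    ultimately show ?thesis by (rule LIMSEQ_unique)
  qed
  obtain p q where pq: "p \<in> I" "q \<in> I" "p < q"
  proof -
    obtain x where "x \<in> I" using I by blast
    then obtain e where "e > 0" "cball x e \<subseteq> I" using I(1) open_contains_cball by blast
    then have "x - e \<in> I" "x + e \<in> I" by (auto simp: cball_eq_atLeastAtMost)
    with \<open>e > 0\<close> show ?thesis by (intro that[of "x - e" "x + e"]) auto
  qed
  define C where "C = integral {p..q} u /\<^sub>R (q - p)"
  have "primitive_on I (\<lambda>_. 0) (\<lambda>x. u x - C)"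
    unfolding primitive_on_def
  proof (intro ballI impI conjI)
    fix s t assume st: "s \<in> I" "t \<in> I" "s \<le> t"
    have C: "(\<lambda>_. C) absolutely_integrable_on {s..t}"
      by (rule absolutely_integrable_continuous_real) auto
    show "(\<lambda>x. u x - C) absolutely_integrable_on {s..t}"
      using u[OF st(1,2)] C by (rule set_integral_diff(1))
    have "integral {s..t} (\<lambda>x. u x - C) = integral {s..t} u - (t - s) *\<^sub>R C"
      using u[OF st(1,2), THEN set_lebesgue_integral_eq_integral(1)] st
      by (subst Henstock_Kurzweil_Integration.integral_diff) auto
    also have "(t - s) *\<^sub>R C = inverse (q - p) *\<^sub>R ((t - s) *\<^sub>R integral {p..q} u)"
      by (simp add: C_def mult.commute)
    also have "\<dots> = integral {s..t} u"
      using pq by (simp flip: average[OF st(1,2) pq(1,2) st(3)])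
    finally show "0 - 0 = integral {s..t} (\<lambda>x. u x - C)" by simp
  qed
  from primitive_on_constant_imp_AE_zero[OF I(1,2) this] have "negligible {x \<in> I. u x \<noteq> C}"
    by simp
  then show ?thesis by (rule that)
qed

lemma compact_subset_open_interval:
  fixes I :: "real set"
  assumes I: "open I" "is_interval I" "I \<noteq> {}" and K: "compact K" "K \<subseteq> I"
  obtains a b where "a \<in> I" "b \<in> I" "a \<le> b" "K \<subseteq> {a<..<b}"
proof (cases "K = {}")
  case True
  then show ?thesis using that I(3) by fastforce
next
  case False
  obtain s where s: "s \<in> K" "\<And>t. t \<in> K \<Longrightarrow> s \<le> t" using compact_attains_inf[OF K(1) False] by blast
  obtain t where t: "t \<in> K" "\<And>s. s \<in> K \<Longrightarrow> s \<le> t" using compact_attains_sup[OF K(1) False] by blast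
  obtain d where d: "d > 0" "cball s d \<subseteq> I" using I(1) s K(2) open_contains_cball by blast
  obtain e where e: "e > 0" "cball t e \<subseteq> I" using I(1) t K(2) open_contains_cball by blast
  show ?thesis
  proof (rule that[of "s - d" "t + e"])
    show "s - d \<in> I" "t + e \<in> I" using d e by (auto simp: cball_eq_atLeastAtMost)
    show "s - d \<le> t + e" using d e s(2)[OF t(1)] by simp
    show "K \<subseteq> {s - d<..<t + e}" using d e s t by force
  qed
qed

section \<open>Integration by parts against test functions\<close>

lemma test_function_has_vector_derivative:
  assumes "test_function I \<eta>"
  shows "((\<lambda>x. complex_of_real (\<eta> x)) has_vector_derivative of_real (deriv \<eta> x)) (at x within S)"
proof -
  have "\<eta> differentiable (at x)" using assms by (simp add: test_function_def differentiable_on_def)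
  then have "(\<eta> has_field_derivative deriv \<eta> x) (at x)"
    using DERIV_deriv_iff_real_differentiable by blast
  then have "(\<eta> has_vector_derivative deriv \<eta> x) (at x within S)"
    using has_real_derivative_iff_has_vector_derivative has_vector_derivative_at_within by blast
  then show ?thesis by (rule bounded_linear.has_vector_derivative[OF bounded_linear_of_real])
qed

lemma test_function_primitive_on:
  assumes \<eta>: "test_function I \<eta>" and S: "is_interval S"
  shows "primitive_on S (\<lambda>x. of_real (\<eta> x)) (\<lambda>x. of_real (deriv \<eta> x))"
  using test_function_has_vector_derivative[OF \<eta>] S
proof (rule has_vector_derivative_primitive_on)
  have "continuous_on S (deriv \<eta>)"
    using \<eta> continuous_on_subset unfolding test_function_def by blast
  then show "continuous_on S (\<lambda>x. complex_of_real (deriv \<eta> x))"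
    by (intro continuous_intros)
qed

text \<open>The support is enclosed strictly, so that \<open>\<eta>\<close> vanishes at
  \<open>a\<close> and \<open>b\<close> themselves and leaves no boundary terms. The derivative
  vanishes off the support because the complement of a compact set is open.\<close>

lemma test_function_support:
  assumes I: "open I" "is_interval I" "I \<noteq> {}" and \<eta>: "test_function I \<eta>"
  obtains a b where "a \<in> I" "b \<in> I" "a \<le> b" "{a..b} \<subseteq> I" "\<eta> a = 0" "\<eta> b = 0"
     "\<And>x. x \<notin> {a..b} \<Longrightarrow> \<eta> x = 0" "\<And>x. x \<notin> {a..b} \<Longrightarrow> deriv \<eta> x = 0"
proof -
  obtain K where K: "compact K" "K \<subseteq> I" "\<And>x. x \<notin> K \<Longrightarrow> \<eta> x = 0"
    using \<eta> unfolding test_function_def by blast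
  obtain a b where ab: "a \<in> I" "b \<in> I" "a \<le> b" "K \<subseteq> {a<..<b}"
    using compact_subset_open_interval[OF I K(1,2)] .
  have "deriv \<eta> x = 0" if "x \<notin> {a..b}" for x
  proof -
    have "x \<in> - K" using that ab by auto
    then have "eventually (\<lambda>y. y \<in> -K) (nhds x)"
      using K(1) by (intro eventually_nhds_in_open) (auto simp: compact_imp_closed open_Compl)
    then have "eventually (\<lambda>y. \<eta> y = 0) (nhds x)"
      by (rule eventually_mono) (use K(3) in auto)
    then have "(\<eta> has_field_derivative 0) (at x)"
      by (subst DERIV_cong_ev[where g = "\<lambda>_. 0"]) auto
    then show ?thesis by (rule DERIV_imp_deriv)
  qed
  moreover have "a \<notin> K" "b \<notin> K" using ab by auto
  ultimately show ?thesis
    using that[OF ab(1-3) interval_Icc_subset[OF I(2) ab(1,2)]] K(3) ab(4)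
    by (metis atLeastAtMost_iff order_less_imp_le subsetD greaterThanLessThan_iff)
qed

text \<open>The product rule for \<open>\<eta> G\<close>, integrated over an interval at whose ends
  \<open>\<eta>\<close> vanishes.\<close>

lemma primitive_on_imp_has_weak_deriv:
  assumes I: "open I" "is_interval I" "I \<noteq> {}" and G: "primitive_on I G g"
  shows "has_weak_deriv I G g"
  unfolding has_weak_deriv_def
proof (intro allI impI)
  fix \<eta> assume \<eta>: "test_function I \<eta>"
  obtain a b where ab: "a \<in> I" "b \<in> I" "a \<le> b" "{a..b} \<subseteq> I" "\<eta> a = 0" "\<eta> b = 0"
     and out: "\<And>x. x \<notin> {a..b} \<Longrightarrow> \<eta> x = 0" "\<And>x. x \<notin> {a..b} \<Longrightarrow> deriv \<eta> x = 0"
    using test_function_support[OF I \<eta>] by blast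
  have meas: "I \<in> sets lebesgue" using I(1) by simp
  note \<eta>' = test_function_primitive_on[OF \<eta> I(2)]
  have c\<eta>: "continuous_on {a..b} (\<lambda>x. complex_of_real (\<eta> x))"
    using primitive_on_continuous_on[OF \<eta>' I(2)] ab(4) continuous_on_subset by blast
  have cG: "continuous_on {a..b} G"
    using primitive_on_continuous_on[OF G I(2)] ab(4) continuous_on_subset by blast
  have i1: "(\<lambda>x. deriv \<eta> x *\<^sub>R G x) absolutely_integrable_on {a..b}"
    using absolutely_integrable_continuous_mult[OF cG primitive_onD(1)[OF \<eta>' ab(1-3)]]
    by (simp add: scaleR_conv_of_real mult.commute)
  have i2: "(\<lambda>x. \<eta> x *\<^sub>R g x) absolutely_integrable_on {a..b}"
    using absolutely_integrable_continuous_mult[OF c\<eta> primitive_onD(1)[OF G ab(1-3)]]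
    by (simp add: scaleR_conv_of_real)
  have "integral {a..b} (\<lambda>x. deriv \<eta> x *\<^sub>R G x + \<eta> x *\<^sub>R g x) = 0"
    using primitive_onD(2)[OF primitive_on_mult[OF \<eta>' G I(2)] ab(1-3)] ab(5,6)
    by (simp add: scaleR_conv_of_real)
  then have "integral {a..b} (\<lambda>x. deriv \<eta> x *\<^sub>R G x) = - integral {a..b} (\<lambda>x. \<eta> x *\<^sub>R g x)"
    using i1[THEN set_lebesgue_integral_eq_integral(1)] i2[THEN set_lebesgue_integral_eq_integral(1)]
    by (simp add: Henstock_Kurzweil_Integration.integral_add eq_neg_iff_add_eq_0)
  then show "(LINT x|lebesgue_on I. deriv \<eta> x *\<^sub>R G x) = - (LINT x|lebesgue_on I. \<eta> x *\<^sub>R g x)"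
    using integral_lebesgue_on_supported(2)[OF meas ab(4) i1]
      integral_lebesgue_on_supported(2)[OF meas ab(4) i2] out by simp
qed

lemma primitive_on_exists:
  assumes S: "is_interval S" "S \<noteq> {}"
    and g: "\<And>a b. a \<in> S \<Longrightarrow> b \<in> S \<Longrightarrow> g absolutely_integrable_on {a..b}"
  obtains G where "primitive_on S G g"
proof -
  obtain c where c: "c \<in> S" using S by blast
  have i: "g integrable_on {a..b}" if "a \<in> S" "b \<in> S" for a b
    using g[OF that] by (rule set_lebesgue_integral_eq_integral(1))
  define G where "G = (\<lambda>x. if c \<le> x then integral {c..x} g else - integral {x..c} g)"
  have "G b - G a = integral {a..b} g" if ab: "a \<in> S" "b \<in> S" "a \<le> b" for a b
  proof -
    consider "c \<le> a" | "a < c" "c \<le> b" | "b < c" by linarith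
    then show ?thesis
    proof cases
      case 1
      then show ?thesis
        using Henstock_Kurzweil_Integration.integral_combine[of c a b g] i[OF c ab(2)] ab
        by (simp add: G_def algebra_simps)
    next
      case 2
      then show ?thesis
        using Henstock_Kurzweil_Integration.integral_combine[of a c b g] i[OF ab(1,2)]
        by (simp add: G_def algebra_simps)
    next
      case 3
      then show ?thesis
        using Henstock_Kurzweil_Integration.integral_combine[of a b c g] i[OF ab(1) c] ab
        by (simp add: G_def algebra_simps)
    qed
  qed
  then have "primitive_on S G g" unfolding primitive_on_def using g by blast
  then show ?thesis by (rule that)
qed

text \<open>Subtracting a primitive of \<open>g\<close> from \<open>f\<close> leaves a function with
  weak derivative zero, which du Bois-Reymond identifies as a constant. Integrability of
  \<open>g\<close> up to the closure carries the primitive to the endpoints, where the vertex values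
  are taken.\<close>

lemma has_weak_deriv_imp_primitive_on:
  assumes I: "open I" "is_interval I" "I \<noteq> {}"
    and f: "\<And>a b. a \<in> I \<Longrightarrow> b \<in> I \<Longrightarrow> f absolutely_integrable_on {a..b}"
    and g: "\<And>a b. a \<in> closure I \<Longrightarrow> b \<in> closure I \<Longrightarrow> g absolutely_integrable_on {a..b}"
    and weak: "has_weak_deriv I f g"
  obtains F where "primitive_on (closure I) F g" "negligible {x \<in> I. F x \<noteq> f x}"
proof -
  have S: "is_interval (closure I)" "closure I \<noteq> {}" "I \<subseteq> closure I"
    using I by (auto simp: is_interval_convex_1 closure_subset)
  obtain G where G: "primitive_on (closure I) G g"
    using primitive_on_exists[OF S(1,2) g] by blast
  have GI: "primitive_on I G g"
    using G S(3) unfolding primitive_on_def by blast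
  have cG: "continuous_on {a..b} G" if "a \<in> I" "b \<in> I" for a b
    using primitive_on_continuous_on[OF GI I(2)] interval_Icc_subset[OF I(2) that] continuous_on_subset by blast
  have meas: "I \<in> sets lebesgue" using I(1) by simp
  have u: "(\<lambda>x. f x - G x) absolutely_integrable_on {a..b}" if "a \<in> I" "b \<in> I" for a b
    using f[OF that] absolutely_integrable_continuous_real[OF cG[OF that]] by (rule set_integral_diff(1))
  have "(LINT x|lebesgue_on I. deriv \<eta> x *\<^sub>R (f x - G x)) = 0" if \<eta>: "test_function I \<eta>" for \<eta>
  proof -
    obtain a b where ab: "a \<in> I" "b \<in> I" "{a..b} \<subseteq> I"
       and out: "\<And>x. x \<notin> {a..b} \<Longrightarrow> deriv \<eta> x = 0"
      using test_function_support[OF I \<eta>] by metis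
    have "continuous_on {a..b} (\<lambda>x. complex_of_real (deriv \<eta> x))"
      using \<eta> unfolding test_function_def by (intro continuous_intros) (auto intro: continuous_on_subset)
    note c = this
    have i: "integrable (lebesgue_on I) (\<lambda>x. deriv \<eta> x *\<^sub>R h x)"
      if "h absolutely_integrable_on {a..b}" for h :: "real \<Rightarrow> complex"
      using integral_lebesgue_on_supported(1)[OF meas ab(3) absolutely_integrable_continuous_mult[OF c that]] out
      by (simp add: scaleR_conv_of_real)
    have "(LINT x|lebesgue_on I. deriv \<eta> x *\<^sub>R (f x - G x)) =
        (LINT x|lebesgue_on I. deriv \<eta> x *\<^sub>R f x) - (LINT x|lebesgue_on I. deriv \<eta> x *\<^sub>R G x)"
      unfolding scaleR_diff_right
      using i[OF f[OF ab(1,2)]] i[OF absolutely_integrable_continuous_real[OF cG[OF ab(1,2)]]]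
      by (rule Bochner_Integration.integral_diff)
    then show ?thesis
      using weak primitive_on_imp_has_weak_deriv[OF I GI] \<eta> unfolding has_weak_deriv_def by simp
  qed
  with u obtain C where C: "negligible {x \<in> I. f x - G x \<noteq> C}"
    using du_Bois_Reymond[OF I] by blast
  show ?thesis
  proof (rule that[of "\<lambda>x. G x + C"])
    show "primitive_on (closure I) (\<lambda>x. G x + C) g"
      using G unfolding primitive_on_def by simp
    show "negligible {x \<in> I. G x + C \<noteq> f x}"
      by (rule negligible_subset[OF C]) auto
  qed
qed

section \<open>Square-integrable functions and weak derivatives\<close>

text \<open>On a bounded interval this follows from \<open>|t| <= 1 + t^2\<close>. Endpoints in the
  closure are allowed, although values outside \<open>I\<close> are arbitrary, because the frontier
  of an interval is a null set.\<close>

lemma L2_imp_integrable_Icc: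
  assumes I: "open I" "is_interval I" and f: "L2 I f" and ab: "a \<in> closure I" "b \<in> closure I"
  shows "f absolutely_integrable_on {a..b}"
proof -
  have meas: "I \<in> sets lebesgue" using I(1) by simp
  have cv: "convex I" "is_interval (closure I)" using I(2) by (simp_all add: is_interval_convex_1)
  have J: "I \<inter> {a..b} \<in> sets lebesgue" using meas by (intro sets.Int) auto
  have "(\<lambda>x. (cmod (f x))\<^sup>2) absolutely_integrable_on I"
    using f meas by (simp add: L2_def integrable_lebesgue_on_iff)
  then have "(\<lambda>x. (cmod (f x))\<^sup>2) absolutely_integrable_on (I \<inter> {a..b})"
    by (rule set_integrable_subset) (use J in auto)
  moreover have "(\<lambda>_. 1::real) absolutely_integrable_on (I \<inter> {a..b})"
    by (rule set_integrable_subset[of _ "{a..b}"])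
      (use J in \<open>auto intro: absolutely_integrable_continuous_real\<close>)
  ultimately have "(\<lambda>x. 1 + (cmod (f x))\<^sup>2) absolutely_integrable_on (I \<inter> {a..b})"
    by (rule set_integral_add(1)[rotated])
  then have bound: "(\<lambda>x. 1 + (cmod (f x))\<^sup>2) integrable_on (I \<inter> {a..b})"
    by (rule set_lebesgue_integral_eq_integral(1))
  have "f absolutely_integrable_on (I \<inter> {a..b})"
  proof (rule measurable_bounded_by_integrable_imp_absolutely_integrable[OF _ J bound])
    show "f \<in> borel_measurable (lebesgue_on (I \<inter> {a..b}))"
      using f unfolding L2_def by (auto intro: measurable_restrict_mono)
    show "norm (f x) \<le> 1 + (cmod (f x))\<^sup>2" for x
      using zero_le_power2[of "cmod (f x) - 1/2"] by (simp add: power2_eq_square algebra_simps)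
  qed
  then show ?thesis
  proof (rule absolutely_integrable_spike_set)
    have "{a..b} \<subseteq> closure I" using interval_Icc_subset[OF cv(2) ab] .
    then have "{a..b} - I \<subseteq> frontier I" using I(1) by (auto simp: frontier_def interior_open)
    then show "negligible {x \<in> {a..b} - I \<inter> {a..b}. f x \<noteq> 0}"
      by (intro negligible_subset[OF negligible_convex_frontier[OF cv(1)]]) auto
  qed (auto intro: empty_imp_negligible)
qed

text \<open>Completeness of Lebesgue measure carries measurability over to \<open>g\<close>; to use
  it, both functions are extended by zero to the whole line.\<close>

lemma L2_cong_AE:
  assumes I: "I \<in> sets lebesgue" and f: "L2 I f" and ae: "AE x in lebesgue_on I. f x = g x"
  shows "L2 I g"
proof -
  have f': "f \<in> borel_measurable (lebesgue_on I)" using f by (simp add: L2_def)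
  then have "(\<lambda>x. if x \<in> I then f x else 0) \<in> borel_measurable lebesgue"
    using borel_measurable_if_I I by blast
  moreover have "AE x in lebesgue. (if x \<in> I then f x else 0) = (if x \<in> I then g x else 0)"
    using ae I by (auto simp: AE_restrict_space_iff)
  ultimately have "(\<lambda>x. if x \<in> I then g x else 0) \<in> borel_measurable lebesgue"
    by (rule borel_measurable_AE)
  then have g: "g \<in> borel_measurable (lebesgue_on I)"
    by (rule borel_measurable_if_D)
  moreover have "integrable (lebesgue_on I) (\<lambda>x. (cmod (g x))\<^sup>2)"
  proof (subst integrable_cong_AE)
    show "integrable (lebesgue_on I) (\<lambda>x. (cmod (f x))\<^sup>2)" using f by (simp add: L2_def)
    show "AE x in lebesgue_on I. (cmod (g x))\<^sup>2 = (cmod (f x))\<^sup>2"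
      using ae by eventually_elim simp
  qed (use f' g in measurable)
  ultimately show ?thesis by (simp add: L2_def)
qed

lemma L2_dominated:
  assumes f: "L2 I f" and g: "g \<in> borel_measurable (lebesgue_on I)"
    and le: "\<And>x. x \<in> I \<Longrightarrow> cmod (g x) \<le> cmod (f x)"
  shows "L2 I g"
proof -
  have "integrable (lebesgue_on I) (\<lambda>x. (cmod (g x))\<^sup>2)"
    by (rule Bochner_Integration.integrable_bound[of _ "\<lambda>x. (cmod (f x))\<^sup>2"])
      (use f g le in \<open>auto simp: L2_def intro!: AE_I2 power_mono\<close>)
  then show ?thesis using g by (simp add: L2_def)
qed

lemma L2_cmult:
  assumes "L2 I f"
  shows "L2 I (\<lambda>x. z * f x)"
  using assms by (auto simp: L2_def norm_mult power_mult_distrib)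

lemma L2_add:
  assumes f: "L2 I f" and g: "L2 I g"
  shows "L2 I (\<lambda>x. f x + g x)"
proof -
  have m: "(\<lambda>x. f x + g x) \<in> borel_measurable (lebesgue_on I)"
    using f g by (auto simp: L2_def)
  have "integrable (lebesgue_on I) (\<lambda>x. (cmod (f x + g x))\<^sup>2)"
  proof (rule Bochner_Integration.integrable_bound)
    show "integrable (lebesgue_on I) (\<lambda>x. 2 * (cmod (f x))\<^sup>2 + 2 * (cmod (g x))\<^sup>2)"
      using f g by (auto simp: L2_def)
    have "(cmod (f x + g x))\<^sup>2 \<le> 2 * (cmod (f x))\<^sup>2 + 2 * (cmod (g x))\<^sup>2" for x
    proof -
      have "(cmod (f x + g x))\<^sup>2 \<le> (cmod (f x) + cmod (g x))\<^sup>2"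
        by (intro power_mono norm_triangle_ineq) auto
      also have "\<dots> \<le> 2 * (cmod (f x))\<^sup>2 + 2 * (cmod (g x))\<^sup>2"
        using zero_le_power2[of "cmod (f x) - cmod (g x)"] by (simp add: power2_eq_square algebra_simps)
      finally show ?thesis .
    qed
    then show "AE x in lebesgue_on I. norm ((cmod (f x + g x))\<^sup>2) \<le> norm (2 * (cmod (f x))\<^sup>2 + 2 * (cmod (g x))\<^sup>2)"
      by auto
  qed (use m in measurable)
  then show ?thesis using m by (simp add: L2_def)
qed

lemma L2_mult_cnj_integrable:
  assumes f: "L2 I f" and g: "L2 I g"
  shows "integrable (lebesgue_on I) (\<lambda>x. f x * cnj (g x))"
proof (rule Bochner_Integration.integrable_bound)
  show "integrable (lebesgue_on I) (\<lambda>x. (cmod (f x))\<^sup>2 + (cmod (g x))\<^sup>2)"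
    using f g by (auto simp: L2_def)
  show "(\<lambda>x. f x * cnj (g x)) \<in> borel_measurable (lebesgue_on I)"
    using f g unfolding L2_def
    by (intro borel_measurable_times) (auto intro: borel_measurable_continuous_on[OF continuous_on_cnj])
  have "cmod (f x) * cmod (g x) \<le> (cmod (f x))\<^sup>2 + (cmod (g x))\<^sup>2" for x
    using sum_squares_bound[of "cmod (f x)" "cmod (g x)"]
      mult_nonneg_nonneg[OF norm_ge_zero[of "f x"] norm_ge_zero[of "g x"]] by linarith
  then show "AE x in lebesgue_on I. norm (f x * cnj (g x)) \<le> norm ((cmod (f x))\<^sup>2 + (cmod (g x))\<^sup>2)"
    by (auto simp: norm_mult)
qed

text \<open>The set in \<open>I\<close> where \<open>F\<close> and \<open>G\<close> differ is open
  and null, hence empty; density extends the equality to the closure.\<close>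

lemma continuous_on_closure_eqI:
  fixes F G :: "real \<Rightarrow> complex"
  assumes I: "open I" and cont: "continuous_on (closure I) F" "continuous_on (closure I) G"
    and ae: "AE x in lebesgue_on I. F x = G x" and x: "x \<in> closure I"
  shows "F x = G x"
proof -
  have cI: "continuous_on I (\<lambda>x. F x - G x)"
    using cont[THEN continuous_on_subset[OF _ closure_subset]] by (rule continuous_on_diff)
  have "open (I \<inter> (\<lambda>x. F x - G x) -` (- {0}))"
    by (rule continuous_open_preimage[OF cI I]) (simp add: open_Compl)
  moreover have "negligible (I \<inter> (\<lambda>x. F x - G x) -` (- {0}))"
    using ae I by (subst (asm) AE_lebesgue_on_iff_negligible) (auto elim: negligible_subset)
  ultimately have "I \<inter> (\<lambda>x. F x - G x) -` (- {0}) = {}"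
    using open_not_negligible by blast
  then have eq: "F y - G y = 0" if "y \<in> I" for y using that by auto
  have "F x - G x = 0"
    by (rule continuous_constant_on_closure[of I "\<lambda>x. F x - G x"])
      (use continuous_on_diff[OF cont] eq x in auto)
  then show ?thesis by simp
qed

text \<open>Makes the choice in \<open>continuous_rep\<close> harmless: every continuous candidate
  has the same values on the closure, endpoints included.\<close>

lemma continuous_rep_eqI:
  assumes I: "open I" and F: "continuous_on (closure I) F" "AE x in lebesgue_on I. F x = f x"
    and x: "x \<in> closure I"
  shows "continuous_rep I f x = F x"
proof -
  have rep: "continuous_on (closure I) (continuous_rep I f) \<and> (AE x in lebesgue_on I. continuous_rep I f x = f x)"
    unfolding continuous_rep_def
    by (rule someI[of "\<lambda>h. continuous_on (closure I) h \<and> (AE x in lebesgue_on I. h x = f x)" F]) (use F in simp)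
  then have "AE x in lebesgue_on I. continuous_rep I f x = f x" by blast
  with F(2) have "AE x in lebesgue_on I. continuous_rep I f x = F x"
    by eventually_elim simp
  then show ?thesis
    using continuous_on_closure_eqI[OF I conjunct1[OF rep] F(1) _ x] by simp
qed

lemma continuous_on_deriv_test_function:
  assumes "test_function I \<eta>"
  shows "continuous_on S (deriv \<eta>)"
  using assms unfolding test_function_def by (auto intro: continuous_on_subset)

lemma has_weak_deriv_cong_AE:
  assumes I: "I \<in> sets lebesgue" and f: "L2 I f" and ae: "AE x in lebesgue_on I. f x = f' x"
    and weak: "has_weak_deriv I f g"
  shows "has_weak_deriv I f' g"
  unfolding has_weak_deriv_def
proof (intro allI impI)
  fix \<eta> assume \<eta>: "test_function I \<eta>"
  have f': "L2 I f'" using L2_cong_AE[OF I f ae] .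
  have [measurable]: "f \<in> borel_measurable (lebesgue_on I)" "f' \<in> borel_measurable (lebesgue_on I)"
      "deriv \<eta> \<in> borel_measurable (lebesgue_on I)"
    using f f' I continuous_imp_measurable_on_sets_lebesgue[OF continuous_on_deriv_test_function[OF \<eta>] I]
    by (auto simp: L2_def)
  have "(LINT x|lebesgue_on I. deriv \<eta> x *\<^sub>R f x) = (LINT x|lebesgue_on I. deriv \<eta> x *\<^sub>R f' x)"
  proof (rule integral_cong_AE)
    show "AE x in lebesgue_on I. deriv \<eta> x *\<^sub>R f x = deriv \<eta> x *\<^sub>R f' x"
      using ae by eventually_elim simp
  qed measurable
  then show "(LINT x|lebesgue_on I. deriv \<eta> x *\<^sub>R f' x) = - (LINT x|lebesgue_on I. \<eta> x *\<^sub>R g x)"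
    using weak \<eta> unfolding has_weak_deriv_def by simp
qed

lemma has_weak_deriv_cmult:
  assumes "has_weak_deriv I f g"
  shows "has_weak_deriv I (\<lambda>x. z * f x) (\<lambda>x. z * g x)"
  using assms unfolding has_weak_deriv_def by (simp flip: mult_scaleR_right)

text \<open>Both candidates have primitives representing \<open>f\<close>. Being continuous, these
  coincide on the closure, so \<open>g - h\<close> has zero integral over each compact
  subinterval.\<close>

lemma has_weak_deriv_unique:
  assumes I: "open I" "is_interval I" "I \<noteq> {}"
    and L2: "L2 I f" "L2 I g" "L2 I h" and weak: "has_weak_deriv I f g" "has_weak_deriv I f h"
  shows "AE x in lebesgue_on I. g x = h x"
proof -
  have sub: "I \<subseteq> closure I" by (rule closure_subset)
  have cl: "is_interval (closure I)" using I(2) by (simp add: is_interval_convex_1)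
  have meas: "I \<in> sets lebesgue" using I(1) by simp
  note loc = L2_imp_integrable_Icc[OF I(1,2)]
  obtain F where F: "primitive_on (closure I) F g" "negligible {x \<in> I. F x \<noteq> f x}"
    using has_weak_deriv_imp_primitive_on[OF I loc[OF L2(1)] loc[OF L2(2)] weak(1)] sub by blast
  obtain G where G: "primitive_on (closure I) G h" "negligible {x \<in> I. G x \<noteq> f x}"
    using has_weak_deriv_imp_primitive_on[OF I loc[OF L2(1)] loc[OF L2(3)] weak(2)] sub by blast
  have "AE x in lebesgue_on I. F x = f x" "AE x in lebesgue_on I. G x = f x"
    using F(2) G(2) meas by (simp_all add: AE_lebesgue_on_iff_negligible)
  then have "AE x in lebesgue_on I. F x = G x" by eventually_elim simp
  then have eq: "F x = G x" if "x \<in> closure I" for x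
    using continuous_on_closure_eqI[OF I(1) primitive_on_continuous_on[OF F(1) cl]
        primitive_on_continuous_on[OF G(1) cl] _ that] by blast
  have "primitive_on I (\<lambda>_. 0) (\<lambda>x. g x - h x)"
    unfolding primitive_on_def
  proof (intro ballI impI conjI)
    fix a b assume ab: "a \<in> I" "b \<in> I" "a \<le> b"
    then have ab': "a \<in> closure I" "b \<in> closure I" using sub by auto
    note g = loc[OF L2(2) ab'] and h = loc[OF L2(3) ab']
    show "(\<lambda>x. g x - h x) absolutely_integrable_on {a..b}"
      using g h by (rule set_integral_diff(1))
    have "integral {a..b} g = integral {a..b} h"
      using primitive_onD(2)[OF F(1) ab' ab(3)] primitive_onD(2)[OF G(1) ab' ab(3)]
      by (simp add: eq ab')
    then show "0 - 0 = integral {a..b} (\<lambda>x. g x - h x)"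
      using g h by (simp add: Henstock_Kurzweil_Integration.integral_diff set_lebesgue_integral_eq_integral(1))
  qed
  from primitive_on_constant_imp_AE_zero[OF I(1,2) this] show ?thesis
    using meas by (simp add: AE_lebesgue_on_iff_negligible)
qed

lemma weak_deriv_properties:
  assumes "L2 I g" "has_weak_deriv I f g"
  shows "L2 I (weak_deriv I f)" "has_weak_deriv I f (weak_deriv I f)"
  using someI[of "\<lambda>g. L2 I g \<and> has_weak_deriv I f g" g] assms unfolding weak_deriv_def by auto

lemma weak_deriv_eq_AE:
  assumes I: "open I" "is_interval I" "I \<noteq> {}"
    and "L2 I f" "L2 I g" "has_weak_deriv I f g"
  shows "AE x in lebesgue_on I. g x = weak_deriv I f x"
  using has_weak_deriv_unique[OF I assms(4,5) weak_deriv_properties(1)[OF assms(5,6)] assms(6)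
      weak_deriv_properties(2)[OF assms(5,6)]] .

text \<open>The recursive definition admits an arbitrary witness at each level, while
  \<open>weak_deriv\<close> is one fixed choice. Uniqueness up to null sets transfers the second
  derivative from the witness to that choice.\<close>

lemma sobolev_2_iff:
  assumes I: "open I" "is_interval I" "I \<noteq> {}"
  shows "sobolev 2 I f \<longleftrightarrow> L2 I f \<and> L2 I (weak_deriv I f) \<and> L2 I (weak_deriv I (weak_deriv I f)) \<and>
     has_weak_deriv I f (weak_deriv I f) \<and> has_weak_deriv I (weak_deriv I f) (weak_deriv I (weak_deriv I f))"
    (is "_ \<longleftrightarrow> ?rhs")
proof
  assume "sobolev 2 I f"
  then obtain g h where gh: "L2 I f" "has_weak_deriv I f g" "L2 I g" "has_weak_deriv I g h" "L2 I h"
    by (auto simp: numeral_2_eq_2)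
  have meas: "I \<in> sets lebesgue" using I(1) by simp
  have "has_weak_deriv I (weak_deriv I f) h"
    by (rule has_weak_deriv_cong_AE[OF meas gh(3) weak_deriv_eq_AE[OF I gh(1,3,2)] gh(4)])
  then show ?rhs
    using gh weak_deriv_properties[OF gh(3,2)] weak_deriv_properties[OF gh(5), of "weak_deriv I f"] by auto
next
  assume ?rhs
  then show "sobolev 2 I f" by (auto simp: numeral_2_eq_2)
qed

lemma weak_deriv_continuous_rep:
  assumes I: "open I" "is_interval I" "I \<noteq> {}"
    and "L2 I f" "L2 I g" "has_weak_deriv I f g"
  shows "primitive_on (closure I) (continuous_rep I f) g"
    and "AE x in lebesgue_on I. continuous_rep I f x = f x"
proof -
  have cl: "is_interval (closure I)" using I(2) by (simp add: is_interval_convex_1)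
  have meas: "I \<in> sets lebesgue" using I(1) by simp
  note loc = L2_imp_integrable_Icc[OF I(1,2)]
  obtain F where F: "primitive_on (closure I) F g" "negligible {x \<in> I. F x \<noteq> f x}"
    using has_weak_deriv_imp_primitive_on[OF I loc[OF assms(4)] loc[OF assms(5)] assms(6)] closure_subset by blast
  have ae: "AE x in lebesgue_on I. F x = f x"
    using F(2) meas by (simp add: AE_lebesgue_on_iff_negligible)
  have eq: "continuous_rep I f x = F x" if "x \<in> closure I" for x
    by (rule continuous_rep_eqI[OF I(1) primitive_on_continuous_on[OF F(1) cl] ae that])
  show "primitive_on (closure I) (continuous_rep I f) g"
    by (rule primitive_on_cong_AE[OF F(1) cl]) (auto simp: eq)
  show "AE x in lebesgue_on I. continuous_rep I f x = f x"
    by (rule lebesgue_on_mono[OF ae]) (use eq closure_subset[of I] in auto)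
qed

section \<open>The quadratic form on one edge\<close>

lemma log_derivative:
  fixes u u1 :: "real \<Rightarrow> real"
  assumes d: "(u has_real_derivative u1 x) (at x within S)"
    and d1: "(u1 has_real_derivative v * u x) (at x within S)" and pos: "u x > 0"
  shows "((\<lambda>x. u1 x / u x) has_real_derivative v - (u1 x / u x)\<^sup>2) (at x within S)"
  using pos by (auto intro!: derivative_eq_intros d d1 simp: power2_eq_square field_simps)

text \<open>Since \<open>f1\<close> is only a primitive of \<open>f2\<close>, the identity is
  expressed through \<open>primitive_on\<close>. Continuity of \<open>V\<close> makes
  \<open>q\<close> continuously differentiable and thus a legitimate factor in the product rule. The
  term \<open>- q^2\<close> of the Riccati equation is exactly what completes the square with the
  cross terms.\<close>

lemma edge_identity:
  fixes u u1 V :: "real \<Rightarrow> real"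
  assumes S: "is_interval S"
    and f: "primitive_on S f f1" "primitive_on S f1 f2"
    and d: "\<And>x. x \<in> S \<Longrightarrow> (u has_real_derivative u1 x) (at x within S)"
    and d1: "\<And>x. x \<in> S \<Longrightarrow> (u1 has_real_derivative V x * u x) (at x within S)"
    and pos: "\<And>x. x \<in> S \<Longrightarrow> u x > 0" and V: "continuous_on S V"
  shows "primitive_on S (\<lambda>x. - f1 x * cnj (f x) + of_real (u1 x / u x) * (f x * cnj (f x)))
    (\<lambda>x. (- f2 x + of_real (V x) * f x) * cnj (f x)
        - (f1 x - of_real (u1 x / u x) * f x) * cnj (f1 x - of_real (u1 x / u x) * f x))"
proof -
  define q where "q = (\<lambda>x. u1 x / u x)"
  have q': "(q has_real_derivative V x - (q x)\<^sup>2) (at x within S)" if "x \<in> S" for x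
    unfolding q_def using log_derivative[OF d[OF that] d1[OF that] pos[OF that]] .
  have q_cont: "continuous_on S q"
    using q' by (auto simp: continuous_on_eq_continuous_within intro: DERIV_continuous)
  have Q: "primitive_on S (\<lambda>x. of_real (q x)) (\<lambda>x. of_real (V x - (q x)\<^sup>2))"
  proof (rule has_vector_derivative_primitive_on[OF _ S])
    show "((\<lambda>x. complex_of_real (q x)) has_vector_derivative of_real (V x - (q x)\<^sup>2)) (at x within S)" if "x \<in> S" for x
      using q'[OF that] unfolding has_real_derivative_iff_has_vector_derivative
      by (rule bounded_linear.has_vector_derivative[OF bounded_linear_of_real])
    show "continuous_on S (\<lambda>x. complex_of_real (V x - (q x)\<^sup>2))"
      by (intro continuous_intros V q_cont)
  qed
  note c = primitive_on_bounded_linear[OF f(1) bounded_linear_cnj]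
  note n = primitive_on_bounded_linear[OF primitive_on_mult[OF f(2) c S] bounded_linear_minus[OF bounded_linear_ident]]
  note r = primitive_on_mult[OF Q primitive_on_mult[OF f(1) c S] S]
  have quot: "u1 x / u x = q x" for x by (simp add: q_def)
  show ?thesis
    unfolding quot
    by (rule primitive_on_cong_AE[OF primitive_on_add[OF n r] S])
      (auto simp: algebra_simps power2_eq_square intro!: empty_imp_negligible)
qed

section \<open>Regularity of a stationary state up to the endpoints\<close>

lemma AE_imp_negligible_closure:
  fixes I :: "real set"
  assumes I: "open I" "is_interval I" and ae: "AE x in lebesgue_on I. P x"
  shows "negligible {x \<in> closure I. \<not> P x}"
proof -
  have "negligible ({x \<in> I. \<not> P x} \<union> frontier I)"
    using ae I negligible_convex_frontier[of I]
    by (intro negligible_Un) (auto simp: AE_lebesgue_on_iff_negligible is_interval_convex_1)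
  then show ?thesis
    by (rule negligible_subset) (use I(1) in \<open>auto simp: frontier_def interior_open\<close>)
qed

text \<open>Bootstrapping: the continuous representative of the weak derivative makes
  \<open>u\<close> differentiable, and the equation then identifies the second derivative almost
  everywhere with a continuous function. Positivity on the closure keeps the logarithm continuous at
  the endpoints too.\<close>

lemma stationary_state_has_derivative:
  assumes I: "open I" "is_interval I" "I \<noteq> {}"
    and cont: "continuous_on (closure I) u" and pos: "\<And>x. x \<in> closure I \<Longrightarrow> u x > 0"
    and sob: "sobolev 2 I (complexify u)" and eq: "stationary_eq I c u"
    and x: "x \<in> closure I"
  defines "u1 \<equiv> \<lambda>x. Re (continuous_rep I (weak_deriv I (complexify u)) x)"
  shows "(u has_real_derivative u1 x) (at x within closure I)"
    and "(u1 has_real_derivative (c - ln (\<bar>u x\<bar>\<^sup>2)) * u x) (at x within closure I)"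
    and "continuous_on (closure I) (\<lambda>x. c - ln (\<bar>u x\<bar>\<^sup>2))"
proof -
  let ?f = "complexify u" and ?S = "closure I"
  define f1 where "f1 = weak_deriv I ?f"
  define f2 where "f2 = weak_deriv I f1"
  define F1 where "F1 = continuous_rep I f1"
  have cl: "is_interval ?S" using I(2) by (simp add: is_interval_convex_1)
  have L2: "L2 I ?f" "L2 I f1" "L2 I f2" and weak: "has_weak_deriv I ?f f1" "has_weak_deriv I f1 f2"
    using sob unfolding sobolev_2_iff[OF I] f1_def f2_def by auto
  note F1 = weak_deriv_continuous_rep[OF I L2(2,3) weak(2), folded F1_def]
  note F0 = weak_deriv_continuous_rep[OF I L2(1,2) weak(1)]
  have cf: "continuous_on ?S ?f" unfolding complexify_def by (intro continuous_intros cont)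
  have eq0: "continuous_rep I ?f y = ?f y" if "y \<in> ?S" for y
    by (rule continuous_rep_eqI[OF I(1) cf _ that]) simp
  have cF1: "continuous_on ?S F1" by (rule primitive_on_continuous_on[OF F1(1) cl])
  have "negligible {x \<in> ?S. f1 x \<noteq> F1 x}"
    using AE_imp_negligible_closure[OF I(1,2) F1(2)] by (simp add: eq_commute)
  then have "primitive_on ?S ?f F1"
    using primitive_on_cong_AE[OF F0(1) cl _ eq0] by blast
  then have "(?f has_vector_derivative F1 x) (at x within ?S)"
    using cl cF1 x by (rule primitive_on_has_vector_derivative)
  from bounded_linear.has_vector_derivative[OF bounded_linear_Re this]
  show "(u has_real_derivative u1 x) (at x within closure I)"
    by (simp add: complexify_def u1_def F1_def f1_def has_real_derivative_iff_has_vector_derivative)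
  show cV: "continuous_on ?S (\<lambda>x. c - ln (\<bar>u x\<bar>\<^sup>2))"
    using pos by (intro continuous_intros cont) force
  let ?g = "\<lambda>x. complex_of_real ((c - ln (\<bar>u x\<bar>\<^sup>2)) * u x)"
  have "AE y in lebesgue_on I. f2 y = ?g y"
    using eq unfolding stationary_eq_def f1_def[symmetric] f2_def[symmetric]
    by eventually_elim (simp add: algebra_simps flip: of_real_diff of_real_mult)
  from primitive_on_cong_AE[OF F1(1) cl AE_imp_negligible_closure[OF I(1,2) this]]
  have "primitive_on ?S F1 ?g" by simp
  moreover have "continuous_on ?S ?g" by (intro continuous_intros cV cont)
  ultimately have "(F1 has_vector_derivative ?g x) (at x within ?S)"
    using primitive_on_has_vector_derivative cl x by blast
  from bounded_linear.has_vector_derivative[OF bounded_linear_Re this]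
  show "(u1 has_real_derivative (c - ln (\<bar>u x\<bar>\<^sup>2)) * u x) (at x within closure I)"
    by (simp add: u1_def F1_def f1_def has_real_derivative_iff_has_vector_derivative)
qed

section \<open>Integrable functions on the half-line and the explicit state there\<close>

lemma integrable_halfline_small:
  fixes F :: "real \<Rightarrow> complex"
  assumes F: "F absolutely_integrable_on {a..}" and e: "e > 0"
  shows "\<exists>x\<ge>N. norm (F x) < e"
proof (rule ccontr)
  assume "\<not> (\<exists>x\<ge>N. norm (F x) < e)"
  then have ge: "norm (F x) \<ge> e" if "x \<ge> N" for x using that by (auto simp: not_less)
  define m where "m = max a N"
  have nF: "(\<lambda>x. norm (F x)) absolutely_integrable_on {a..}"
    using absolutely_integrable_norm[OF F] by (simp add: o_def)
  define B where "B = integral {a..} (\<lambda>x. norm (F x))"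
  have "e * t \<le> B" if "t \<ge> 0" for t
  proof -
    have sub: "{m..m+t} \<subseteq> {a..}" by (auto simp: m_def)
    have i: "(\<lambda>x. norm (F x)) integrable_on {m..m+t}"
      using absolutely_integrable_on_subinterval[OF nF sub] by (rule set_lebesgue_integral_eq_integral(1))
    have "e * t = integral {m..m+t} (\<lambda>_. e)" using that by simp
    also have "\<dots> \<le> integral {m..m+t} (\<lambda>x. norm (F x))"
      by (rule integral_le[OF _ i]) (auto intro!: ge simp: m_def)
    also have "\<dots> \<le> B" unfolding B_def
      by (rule integral_subset_le[OF sub i set_lebesgue_integral_eq_integral(1)[OF nF]]) auto
    finally show ?thesis .
  qed
  \<comment> \<open>The length is chosen so that the lower bound becomes \<open>|B| + 1\<close>,
    which exceeds \<open>B\<close>.\<close>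
  from this[of "(\<bar>B\<bar> + 1) / e"] e show False by simp
qed

lemma integrable_halfline_limit_zero:
  fixes F :: "real \<Rightarrow> complex"
  assumes F: "F absolutely_integrable_on {a..}" and lim: "(F \<longlongrightarrow> l) at_top"
  shows "l = 0"
proof (rule ccontr)
  assume "l \<noteq> 0"
  then have "eventually (\<lambda>x. norm (F x) > norm l / 2) at_top"
    by (intro order_tendstoD(1)[OF tendsto_norm[OF lim]]) simp
  then obtain N where N: "\<And>x. x \<ge> N \<Longrightarrow> norm (F x) > norm l / 2"
    by (auto simp: eventually_at_top_linorder)
  then show False
    using integrable_halfline_small[OF F, of "norm l / 2" N] \<open>l \<noteq> 0\<close> by force
qed

lemma integral_halfline_tendsto:
  fixes h :: "real \<Rightarrow> complex"
  assumes h: "h absolutely_integrable_on {a..}"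
  shows "((\<lambda>b. integral {a..b} h) \<longlongrightarrow> integral {a..} h) at_top"
proof -
  have "((\<lambda>b. LINT x:{a..b}|lebesgue. h x) \<longlongrightarrow> (LINT x:{a..}|lebesgue. h x)) at_top"
    by (rule tendsto_set_lebesgue_integral_at_top[OF _ h]) auto
  moreover have "(LINT x:{a..b}|lebesgue. h x) = integral {a..b} h" for b
    by (rule set_lebesgue_integral_eq_integral(2)[OF absolutely_integrable_on_subinterval[OF h]]) auto
  ultimately show ?thesis by (simp add: set_lebesgue_integral_eq_integral(2)[OF h])
qed

text \<open>Integrability of \<open>h\<close> gives \<open>F\<close> a limit at infinity, and
  integrability of \<open>F\<close> forces this limit to be zero. This takes the place of a
  pointwise decay estimate.\<close>

lemma primitive_on_halfline_integral:
  assumes F: "primitive_on {a..} F h" and int: "F absolutely_integrable_on {a..}" "h absolutely_integrable_on {a..}"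
  shows "integral {a..} h = - F a"
proof -
  have "((\<lambda>b. F a + integral {a..b} h) \<longlongrightarrow> F a + integral {a..} h) at_top"
    by (intro tendsto_intros integral_halfline_tendsto int)
  moreover have "eventually (\<lambda>b. F a + integral {a..b} h = F b) at_top"
    using eventually_ge_at_top[of a]
  proof eventually_elim
    case (elim b)
    then show ?case using primitive_onD(2)[OF F, of a b] by simp
  qed
  ultimately have "(F \<longlongrightarrow> F a + integral {a..} h) at_top"
    by (rule Lim_transform_eventually)
  from integrable_halfline_limit_zero[OF int(1) this] show ?thesis
    by (simp add: eq_neg_iff_add_eq_0 add.commute)
qed

text \<open>
  The energy \<open>\<psi>'\<^sup>2 - (c + 1) \<psi>\<^sup>2 + \<psi>\<^sup>2 ln (\<psi>\<^sup>2)\<close> is constant, and its constant value is zero by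
  integrability; hence \<open>\<psi>'/\<psi>\<close> has derivative \<open>-1\<close>.
\<close>

lemma halfline_state:
  assumes d: "\<And>x. x \<ge> L \<Longrightarrow> (\<psi> has_real_derivative \<psi>1 x) (at x within {L..})"
    and d1: "\<And>x. x \<ge> L \<Longrightarrow> (\<psi>1 has_real_derivative (c - ln (\<bar>\<psi> x\<bar>\<^sup>2)) * \<psi> x) (at x within {L..})"
    and pos: "\<And>x. x \<ge> L \<Longrightarrow> \<psi> x > 0"
    and mono: "\<And>x y. L \<le> x \<Longrightarrow> x \<le> y \<Longrightarrow> \<psi> y \<le> \<psi> x"
    and int: "(\<lambda>x. complex_of_real ((\<psi> x)\<^sup>2)) absolutely_integrable_on {L..}"
      "(\<lambda>x. complex_of_real ((\<psi>1 x)\<^sup>2)) absolutely_integrable_on {L..}"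
  obtains k where "\<And>x. x \<ge> L \<Longrightarrow> \<psi>1 x / \<psi> x = k - x"
    "\<And>x. x \<ge> L \<Longrightarrow> c - ln (\<bar>\<psi> x\<bar>\<^sup>2) = (k - x)\<^sup>2 - 1"
proof -
  have ln2: "ln (\<bar>\<psi> x\<bar>\<^sup>2) = 2 * ln (\<psi> x)" if "x \<ge> L" for x
    using pos[OF that] by (simp add: ln_realpow)
  define E where "E = (\<lambda>x. (\<psi>1 x)\<^sup>2 - (c + 1) * (\<psi> x)\<^sup>2 + 2 * (\<psi> x)\<^sup>2 * ln (\<psi> x))"
  have "(E has_real_derivative 0) (at x within {L..})" if "x \<in> {L..}" for x
    unfolding E_def using that pos[of x] ln2[of x]
    by (auto intro!: derivative_eq_intros d d1 simp: power2_eq_square field_simps)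
  then obtain E0 where E0: "\<And>x. x \<ge> L \<Longrightarrow> E x = E0"
    using has_field_derivative_zero_constant[of "{L..}" E] by auto
  \<comment> \<open>Square-integrability provides a small value somewhere, and monotonicity keeps
    all later values below it.\<close>
  have \<psi>0: "(\<psi> \<longlongrightarrow> 0) at_top"
  proof (rule tendstoI)
    fix e :: real assume "e > 0"
    then obtain y where y: "y \<ge> L" "(\<psi> y)\<^sup>2 < e\<^sup>2"
      using integrable_halfline_small[OF int(1), of "e\<^sup>2" L] by (auto simp: norm_power)
    then have "\<psi> y < e" using \<open>e > 0\<close> by (simp add: power2_less_imp_less)
    then have "dist (\<psi> x) 0 < e" if "x \<ge> y" for x
      using mono[OF y(1) that] pos[of x] y(1) that by simp
    then show "eventually (\<lambda>x. dist (\<psi> x) 0 < e) at_top"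
      unfolding eventually_at_top_linorder by blast
  qed
  have "((\<lambda>x. (\<psi> x)\<^sup>2 * ln (\<psi> x)) \<longlongrightarrow> 0) at_top"
  proof (rule Lim_null_comparison[OF _ \<psi>0])
    have "eventually (\<lambda>x. \<psi> x < 1) at_top" using \<psi>0 by (rule order_tendstoD) simp
    then show "eventually (\<lambda>x. norm ((\<psi> x)\<^sup>2 * ln (\<psi> x)) \<le> \<psi> x) at_top"
      using eventually_ge_at_top[of L]
    proof eventually_elim
      case (elim x)
      \<comment> \<open>By \<open>ln y <= y\<close> at \<open>y = 1 / \<psi> x\<close>, the product
        is dominated by \<open>\<psi> x\<close> once \<open>\<psi> x < 1\<close>.\<close>
      have "- ln (\<psi> x) \<le> 1 / \<psi> x"
        using ln_bound[of "1 / \<psi> x"] pos[OF elim(2)] by (simp add: ln_div)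
      then have "(\<psi> x)\<^sup>2 * (- ln (\<psi> x)) \<le> (\<psi> x)\<^sup>2 * (1 / \<psi> x)"
        by (rule mult_left_mono) simp
      then show ?case
        using elim pos[OF elim(2)] by (simp add: abs_mult power2_eq_square)
    qed
  qed
  \<comment> \<open>Solving the conserved energy for the square of \<open>\<psi>1\<close> shows that
    this square tends to \<open>E0\<close>; its integrability leaves only
    \<open>E0 = 0\<close>.\<close>
  from tendsto_diff[OF tendsto_add[OF tendsto_const tendsto_mult[OF tendsto_const tendsto_power[OF \<psi>0]]]
      tendsto_mult[OF tendsto_const this], of E0 "c + 1" 2 2]
  have "((\<lambda>x. E0 + (c + 1) * (\<psi> x)\<^sup>2 - 2 * (\<psi> x)\<^sup>2 * ln (\<psi> x)) \<longlongrightarrow> E0) at_top"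
    by (simp add: mult.assoc)
  moreover have "eventually (\<lambda>x. E0 + (c + 1) * (\<psi> x)\<^sup>2 - 2 * (\<psi> x)\<^sup>2 * ln (\<psi> x) = (\<psi>1 x)\<^sup>2) at_top"
    using eventually_ge_at_top[of L] by eventually_elim (use E0 in \<open>force simp: E_def\<close>)
  ultimately have "((\<lambda>x. (\<psi>1 x)\<^sup>2) \<longlongrightarrow> E0) at_top"
    by (rule Lim_transform_eventually)
  then have "((\<lambda>x. complex_of_real ((\<psi>1 x)\<^sup>2)) \<longlongrightarrow> of_real E0) at_top"
    by (rule tendsto_of_real)
  from integrable_halfline_limit_zero[OF int(2) this] have "E0 = 0" by simp
  define p where "p = (\<lambda>x. \<psi>1 x / \<psi> x)"
  \<comment> \<open>Zero energy divided by the square of \<open>\<psi>\<close> gives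
    \<open>V = p^2 - 1\<close>.\<close>
  have p2: "c - ln (\<bar>\<psi> x\<bar>\<^sup>2) = (p x)\<^sup>2 - 1" if "x \<ge> L" for x
  proof -
    have "(\<psi>1 x)\<^sup>2 = (c + 1 - 2 * ln (\<psi> x)) * (\<psi> x)\<^sup>2"
      using E0[OF that] \<open>E0 = 0\<close> by (simp add: E_def algebra_simps)
    then show ?thesis
      using pos[OF that] ln2[OF that] by (simp add: p_def power_divide)
  qed
  \<comment> \<open>The Riccati equation turns into \<open>p' = -1\<close>, so no sign of a square
    root has to be chosen. For a Gaussian with exponent \<open>- (x - L + a)^2 / 2\<close> the
    constant \<open>k\<close> is \<open>L - a\<close>.\<close>
  have "((\<lambda>x. p x + x) has_real_derivative 0) (at x within {L..})" if "x \<in> {L..}" for x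
  proof -
    have x: "x \<ge> L" using that by simp
    show ?thesis
      using DERIV_add[OF log_derivative[OF d[OF x] d1[OF x] pos[OF x], folded p_def] DERIV_ident]
      unfolding p2[OF x] by (simp add: p_def)
  qed
  then obtain k where k: "\<And>x. x \<ge> L \<Longrightarrow> p x + x = k"
    using has_field_derivative_zero_constant[of "{L..}" "\<lambda>x. p x + x"] by auto
  have pk: "p x = k - x" if "x \<ge> L" for x using k[OF that] by simp
  show ?thesis
    by (rule that[of k]) (use pk p2 in \<open>auto simp: p_def\<close>)
qed

section \<open>Flux balance on a single edge\<close>

definition edge_flux :: "real set \<Rightarrow> (real \<Rightarrow> real) \<Rightarrow> (real \<Rightarrow> complex) \<Rightarrow> real \<Rightarrow> complex" where
  "edge_flux I q f x = - continuous_rep I (weak_deriv I f) x * cnj (continuous_rep I f x)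
     + of_real (q x) * (continuous_rep I f x * cnj (continuous_rep I f x))"

text \<open>With \<open>q = u'/u\<close> this is \<open>u (f/u)'\<close>, so it measures how far
  \<open>f\<close> is from being a multiple of \<open>u\<close>. Continuous representatives match
  those in the flux, whose endpoint values matter.\<close>

definition edge_defect :: "real set \<Rightarrow> (real \<Rightarrow> real) \<Rightarrow> (real \<Rightarrow> complex) \<Rightarrow> real \<Rightarrow> complex" where
  "edge_defect I q f x = continuous_rep I (weak_deriv I f) x - of_real (q x) * continuous_rep I f x"

lemma integral_closure_open_interval:
  fixes h :: "real \<Rightarrow> complex"
  assumes I: "open I" "is_interval I" and h: "integrable (lebesgue_on I) h"
  shows "h absolutely_integrable_on closure I" "integral (closure I) h = (LINT x|lebesgue_on I. h x)"
proof -
  have meas: "I \<in> sets lebesgue" using I(1) by simp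
  have neg: "negligible (closure I - I)"
    using negligible_convex_frontier[of I] I by (simp add: frontier_def interior_open is_interval_convex_1)
  have "h absolutely_integrable_on I" using h meas by (simp add: integrable_lebesgue_on_iff)
  then show "h absolutely_integrable_on closure I"
    by (rule absolutely_integrable_spike_set)
      (use closure_subset[of I] neg in \<open>auto intro: negligible_subset\<close>)
  have "(LINT x|lebesgue_on I. h x) = integral I h"
    by (rule lebesgue_integral_eq_integral[OF h meas])
  also have "\<dots> = integral (closure I) h"
    by (rule integral_spike_set)
      (use closure_subset[of I] neg in \<open>auto intro: negligible_subset\<close>)
  finally show "integral (closure I) h = (LINT x|lebesgue_on I. h x)" ..
qed

lemma integrable_cong_AE_lebesgue_on:
  fixes f g :: "real \<Rightarrow> complex"
  assumes I: "I \<in> sets lebesgue" and f: "integrable (lebesgue_on I) f"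
    and ae: "AE x in lebesgue_on I. f x = g x"
  shows "integrable (lebesgue_on I) g"
proof -
  have "negligible {x \<in> I. f x \<noteq> g x}"
    using ae I by (simp add: AE_lebesgue_on_iff_negligible)
  then have "g absolutely_integrable_on I"
    by (rule absolutely_integrable_spike[rotated]) (use f I in \<open>auto simp: integrable_lebesgue_on_iff\<close>)
  then show ?thesis using I by (simp add: integrable_lebesgue_on_iff)
qed

text \<open>Only the linear equation \<open>u'' = V u\<close> with a positive solution enters, so
  the bounded ring and the unbounded half-line share one computation.\<close>

locale edge_state =
  fixes I :: "real set" and u u1 V :: "real \<Rightarrow> real"
  assumes I: "open I" "is_interval I" "I \<noteq> {}"
    and deriv: "x \<in> closure I \<Longrightarrow> (u has_real_derivative u1 x) (at x within closure I)"
    and deriv2: "x \<in> closure I \<Longrightarrow> (u1 has_real_derivative V x * u x) (at x within closure I)"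
    and pos: "x \<in> closure I \<Longrightarrow> u x > 0"
    and V_cont: "continuous_on (closure I) V"
begin

abbreviation q :: "real \<Rightarrow> real" where "q x \<equiv> u1 x / u x"

lemma meas: "I \<in> sets lebesgue"
  using I(1) by simp

lemma closure_interval: "is_interval (closure I)"
  using I(2) by (simp add: is_interval_convex_1)

lemma u_cont: "continuous_on (closure I) u" and u1_cont: "continuous_on (closure I) u1"
  using deriv deriv2 by (auto simp: continuous_on_eq_continuous_within intro: DERIV_continuous)

lemma q_cont: "continuous_on (closure I) q"
  using pos by (intro continuous_on_divide u_cont u1_cont) force

context
  fixes f :: "real \<Rightarrow> complex"
  assumes f: "sobolev 2 I f"
begin

lemma sobolev_parts:
  "L2 I f" "L2 I (weak_deriv I f)" "L2 I (weak_deriv I (weak_deriv I f))"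
  "has_weak_deriv I f (weak_deriv I f)" "has_weak_deriv I (weak_deriv I f) (weak_deriv I (weak_deriv I f))"
  using f unfolding sobolev_2_iff[OF I] by auto

lemma rep_AE:
  "AE x in lebesgue_on I. continuous_rep I f x = f x"
  "AE x in lebesgue_on I. continuous_rep I (weak_deriv I f) x = weak_deriv I f x"
  using weak_deriv_continuous_rep(2)[OF I] sobolev_parts by blast+

lemma primitive_rep:
  "primitive_on (closure I) (continuous_rep I f) (continuous_rep I (weak_deriv I f))"
  "primitive_on (closure I) (continuous_rep I (weak_deriv I f)) (weak_deriv I (weak_deriv I f))"
proof -
  have "primitive_on (closure I) (continuous_rep I f) (weak_deriv I f)"
    using weak_deriv_continuous_rep(1)[OF I] sobolev_parts by blast
  moreover have "negligible {x \<in> closure I. weak_deriv I f x \<noteq> continuous_rep I (weak_deriv I f) x}"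
    using AE_imp_negligible_closure[OF I(1,2) rep_AE(2)] by (simp add: eq_commute)
  ultimately show "primitive_on (closure I) (continuous_rep I f) (continuous_rep I (weak_deriv I f))"
    using primitive_on_cong_AE closure_interval by blast
  show "primitive_on (closure I) (continuous_rep I (weak_deriv I f)) (weak_deriv I (weak_deriv I f))"
    using weak_deriv_continuous_rep(1)[OF I] sobolev_parts by blast
qed

lemma edge_flux_primitive:
  "primitive_on (closure I) (edge_flux I q f)
     (\<lambda>x. schroedinger I V f x * cnj (f x) - of_real ((cmod (edge_defect I q f x))\<^sup>2))"
proof (rule primitive_on_cong_AE[OF
      edge_identity[OF closure_interval primitive_rep deriv deriv2 pos V_cont] closure_interval])
  show "negligible {x \<in> closure I.
     (- weak_deriv I (weak_deriv I f) x + of_real (V x) * continuous_rep I f x) * cnj (continuous_rep I f x)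
     - (continuous_rep I (weak_deriv I f) x - of_real (q x) * continuous_rep I f x) *
        cnj (continuous_rep I (weak_deriv I f) x - of_real (q x) * continuous_rep I f x) \<noteq>
     schroedinger I V f x * cnj (f x) - of_real ((cmod (edge_defect I q f x))\<^sup>2)}"
    unfolding schroedinger_def edge_defect_def complex_norm_square
    by (rule negligible_subset[OF AE_imp_negligible_closure[OF I(1,2) rep_AE(1)]]) auto
qed (simp_all add: edge_flux_def)

text \<open>The two weighted hypotheses are what each edge has to supply: on the ring they come from
  boundedness, on the half-line from the weight \<open>x^2\<close>. They make the operator
  square-integrable and the flux integrable.\<close>

lemma edge_integrals:
  assumes Vf: "L2 I (\<lambda>x. of_real (V x) * f x)" and qf: "L2 I (\<lambda>x. of_real (q x) * f x)"
  shows "L2 I (schroedinger I V f)"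
    and "edge_flux I q f absolutely_integrable_on closure I"
    and "integrable (lebesgue_on I) (\<lambda>x. (cmod (edge_defect I q f x))\<^sup>2)"
    and "(\<lambda>x. schroedinger I V f x * cnj (f x) - of_real ((cmod (edge_defect I q f x))\<^sup>2))
      absolutely_integrable_on closure I"
    and "integral (closure I)
       (\<lambda>x. schroedinger I V f x * cnj (f x) - of_real ((cmod (edge_defect I q f x))\<^sup>2)) =
      (LINT x|lebesgue_on I. schroedinger I V f x * cnj (f x))
       - of_real (LINT x|lebesgue_on I. (cmod (edge_defect I q f x))\<^sup>2)"
proof -
  show T: "L2 I (schroedinger I V f)"
    using L2_add[OF L2_cmult[OF sobolev_parts(3), of "-1"] Vf]
    by (simp add: schroedinger_def[abs_def])
  have "L2 I (\<lambda>x. weak_deriv I f x + - 1 * (of_real (q x) * f x))"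
    by (intro L2_add L2_cmult sobolev_parts qf)
  moreover have "AE x in lebesgue_on I. weak_deriv I f x + - 1 * (of_real (q x) * f x) = edge_defect I q f x"
    using rep_AE by eventually_elim (simp add: edge_defect_def)
  ultimately have "L2 I (edge_defect I q f)"
    by (rule L2_cong_AE[OF meas])
  then show w: "integrable (lebesgue_on I) (\<lambda>x. (cmod (edge_defect I q f x))\<^sup>2)"
    by (simp add: L2_def)
  have "integrable (lebesgue_on I) (\<lambda>x. - (weak_deriv I f x * cnj (f x)) + (of_real (q x) * f x) * cnj (f x))"
    by (intro Bochner_Integration.integrable_add Bochner_Integration.integrable_minus
        L2_mult_cnj_integrable sobolev_parts qf)
  moreover have "AE x in lebesgue_on I. - (weak_deriv I f x * cnj (f x)) + (of_real (q x) * f x) * cnj (f x)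
      = edge_flux I q f x"
    using rep_AE by eventually_elim (simp add: edge_flux_def)
  ultimately have "integrable (lebesgue_on I) (edge_flux I q f)"
    by (rule integrable_cong_AE_lebesgue_on[OF meas])
  then show "edge_flux I q f absolutely_integrable_on closure I"
    by (rule integral_closure_open_interval(1)[OF I(1,2)])
  note Tf = L2_mult_cnj_integrable[OF T sobolev_parts(1)]
  have wc: "integrable (lebesgue_on I) (\<lambda>x. complex_of_real ((cmod (edge_defect I q f x))\<^sup>2))"
    using w by (rule integrable_of_real)
  note d = Bochner_Integration.integrable_diff[OF Tf wc]
  show "(\<lambda>x. schroedinger I V f x * cnj (f x) - of_real ((cmod (edge_defect I q f x))\<^sup>2))
      absolutely_integrable_on closure I"
    by (rule integral_closure_open_interval(1)[OF I(1,2) d])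
  show "integral (closure I)
       (\<lambda>x. schroedinger I V f x * cnj (f x) - of_real ((cmod (edge_defect I q f x))\<^sup>2)) =
      (LINT x|lebesgue_on I. schroedinger I V f x * cnj (f x))
       - of_real (LINT x|lebesgue_on I. (cmod (edge_defect I q f x))\<^sup>2)"
    unfolding integral_closure_open_interval(2)[OF I(1,2) d] Bochner_Integration.integral_diff[OF Tf wc]
      integral_complex_of_real ..
qed

text \<open>The derivative of \<open>f/u\<close> is the defect divided by \<open>u\<close>. Being a
  primitive of zero, the quotient is constant.\<close>

lemma edge_defect_zero_imp_multiple:
  assumes ae: "AE x in lebesgue_on I. edge_defect I q f x = 0"
  obtains z where "\<And>x. x \<in> closure I \<Longrightarrow> continuous_rep I f x = z * of_real (u x)"
proof -
  have inv: "primitive_on (closure I) (\<lambda>x. of_real (1 / u x)) (\<lambda>x. complex_of_real (- u1 x / (u x)\<^sup>2))"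
  proof (rule has_vector_derivative_primitive_on[OF _ closure_interval])
    show "((\<lambda>x. complex_of_real (1 / u x)) has_vector_derivative of_real (- u1 x / (u x)\<^sup>2)) (at x within closure I)"
      if x: "x \<in> closure I" for x
    proof -
      have "((\<lambda>x. 1 / u x) has_real_derivative - u1 x / (u x)\<^sup>2) (at x within closure I)"
        using pos[OF x] by (auto intro!: derivative_eq_intros deriv x simp: power2_eq_square)
      then show ?thesis
        unfolding has_real_derivative_iff_has_vector_derivative
        by (rule bounded_linear.has_vector_derivative[OF bounded_linear_of_real])
    qed
    show "continuous_on (closure I) (\<lambda>x. complex_of_real (- u1 x / (u x)\<^sup>2))"
      using pos by (intro continuous_intros u_cont u1_cont) force
  qed
  have const: "primitive_on (closure I) (\<lambda>x. continuous_rep I f x * of_real (1 / u x)) (\<lambda>_. 0)"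
  proof (rule primitive_on_cong_AE[OF primitive_on_mult[OF primitive_rep(1) inv closure_interval] closure_interval])
    have "continuous_rep I (weak_deriv I f) x * of_real (1 / u x)
        + continuous_rep I f x * complex_of_real (- u1 x / (u x)\<^sup>2) = 0"
      if "x \<in> closure I" "edge_defect I q f x = 0" for x
      using that pos[OF that(1)] by (simp add: edge_defect_def power2_eq_square)
    then show "negligible {x \<in> closure I. continuous_rep I (weak_deriv I f) x * of_real (1 / u x)
        + continuous_rep I f x * complex_of_real (- u1 x / (u x)\<^sup>2) \<noteq> 0}"
      by (intro negligible_subset[OF AE_imp_negligible_closure[OF I(1,2) ae]]) blast
  qed simp
  obtain a where a: "a \<in> closure I" using I(3) closure_subset by blast
  define z where "z = continuous_rep I f a * of_real (1 / u a)"
  \<comment> \<open>Primitives compare ordered endpoints only, so \<open>x\<close> is treated on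
    either side of the base point \<open>a\<close>.\<close>
  have "continuous_rep I f x * of_real (1 / u x) = z" if x: "x \<in> closure I" for x
    using primitive_onD(2)[OF const a x] primitive_onD(2)[OF const x a]
    by (cases "a \<le> x") (simp_all add: z_def)
  then have "continuous_rep I f x = z * of_real (u x)" if "x \<in> closure I" for x
    using pos[OF that] that by (fastforce simp: field_simps)
  then show ?thesis by (rule that)
qed

end

end

text \<open>A weight of at most quadratic growth is admissible because
  \<open>(a + b * x^2) g\<close> is a combination of the two given functions. It serves for both
  \<open>V\<close> and \<open>q\<close> on the half-line.\<close>

lemma L2_polynomial_weight:
  assumes g: "L2 I g" "L2 I (\<lambda>x. x\<^sup>2 *\<^sub>R g x)" and I: "I \<in> sets lebesgue"
    and P: "continuous_on I P" and bound: "\<And>x. x \<in> I \<Longrightarrow> \<bar>P x\<bar> \<le> a + b * x\<^sup>2"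
  shows "L2 I (\<lambda>x. of_real (P x) * g x)"
proof (rule L2_dominated)
  show "L2 I (\<lambda>x. of_real a * g x + of_real b * (x\<^sup>2 *\<^sub>R g x))"
    by (intro L2_add L2_cmult g)
  have "(\<lambda>x. complex_of_real (P x)) \<in> borel_measurable (lebesgue_on I)"
    by (intro continuous_imp_measurable_on_sets_lebesgue continuous_intros P I)
  then show "(\<lambda>x. of_real (P x) * g x) \<in> borel_measurable (lebesgue_on I)"
    using g(1) unfolding L2_def by (intro borel_measurable_times) auto
  show "cmod (of_real (P x) * g x) \<le> cmod (of_real a * g x + of_real b * (x\<^sup>2 *\<^sub>R g x))" if "x \<in> I" for x
  proof -
    have "of_real a * g x + of_real b * (x\<^sup>2 *\<^sub>R g x) = of_real (a + b * x\<^sup>2) * g x"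
      by (simp add: algebra_simps scaleR_conv_of_real)
    then show ?thesis
      using bound[OF that] by (simp only: norm_mult norm_of_real) (intro mult_right_mono, auto)
  qed
qed

section \<open>The single-lobe state\<close>

text \<open>The span is taken modulo null sets, so a member only agrees almost everywhere with a
  multiple of the state. Its derivatives and vertex values, being choices, have to be identified
  with those of the multiple before the domain conditions can be checked.\<close>

lemma sobolev_2_multiple:
  assumes I: "open I" "is_interval I" "I \<noteq> {}"
    and h: "sobolev 2 I h" and ae: "AE x in lebesgue_on I. z * h x = f x"
  shows "sobolev 2 I f"
    and "AE x in lebesgue_on I. z * weak_deriv I (weak_deriv I h) x = weak_deriv I (weak_deriv I f) x"
    and "x \<in> closure I \<Longrightarrow> continuous_rep I f x = z * continuous_rep I h x"
    and "x \<in> closure I \<Longrightarrow>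
      continuous_rep I (weak_deriv I f) x = z * continuous_rep I (weak_deriv I h) x"
proof -
  define h1 where "h1 = weak_deriv I h"
  define h2 where "h2 = weak_deriv I h1"
  have L2: "L2 I h" "L2 I h1" "L2 I h2" and weak: "has_weak_deriv I h h1" "has_weak_deriv I h1 h2"
    using h unfolding sobolev_2_iff[OF I] h1_def h2_def by auto
  have meas: "I \<in> sets lebesgue" using I(1) by simp
  have cl: "is_interval (closure I)" using I(2) by (simp add: is_interval_convex_1)
  have L2f: "L2 I f" using L2_cong_AE[OF meas L2_cmult[OF L2(1)] ae] .
  have weak_f: "has_weak_deriv I f (\<lambda>x. z * h1 x)"
    by (rule has_weak_deriv_cong_AE[OF meas L2_cmult[OF L2(1)] ae has_weak_deriv_cmult[OF weak(1)]])
  have "sobolev (Suc 0) I (\<lambda>x. z * h1 x)"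
    using L2_cmult[OF L2(2)] has_weak_deriv_cmult[OF weak(2)] L2_cmult[OF L2(3)]
    by (auto intro: exI[of _ "\<lambda>x. z * h2 x"])
  then show sob: "sobolev 2 I f"
    using L2f weak_f unfolding numeral_2_eq_2 sobolev.simps(2)[of "Suc 0"]
    by (intro conjI exI[of _ "\<lambda>x. z * h1 x"])
  have ae1: "AE x in lebesgue_on I. z * h1 x = weak_deriv I f x"
    by (rule weak_deriv_eq_AE[OF I L2f L2_cmult[OF L2(2)] weak_f])
  have L2f1: "L2 I (weak_deriv I f)" using sob unfolding sobolev_2_iff[OF I] by simp
  have "has_weak_deriv I (weak_deriv I f) (\<lambda>x. z * h2 x)"
    by (rule has_weak_deriv_cong_AE[OF meas L2_cmult[OF L2(2)] ae1 has_weak_deriv_cmult[OF weak(2)]])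
  from weak_deriv_eq_AE[OF I L2f1 L2_cmult[OF L2(3)] this]
  show "AE x in lebesgue_on I. z * weak_deriv I (weak_deriv I h) x = weak_deriv I (weak_deriv I f) x"
    by (simp add: h1_def h2_def)
  have rep: "continuous_rep I k x = z * continuous_rep I j x"
    if "L2 I j" "L2 I j1" "has_weak_deriv I j j1" "AE x in lebesgue_on I. z * j x = k x" "x \<in> closure I"
    for j j1 k x
  proof (rule continuous_rep_eqI[OF I(1) _ _ that(5)])
    note j = weak_deriv_continuous_rep[OF I that(1-3)]
    show "continuous_on (closure I) (\<lambda>x. z * continuous_rep I j x)"
      by (intro continuous_intros primitive_on_continuous_on[OF j(1) cl])
    show "AE x in lebesgue_on I. z * continuous_rep I j x = k x"
      using j(2) that(4) by eventually_elim simp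
  qed
  show "continuous_rep I f x = z * continuous_rep I h x" if "x \<in> closure I"
    by (rule rep[OF L2(1,2) weak(1) ae that])
  show "continuous_rep I (weak_deriv I f) x = z * continuous_rep I (weak_deriv I h) x" if "x \<in> closure I"
    using rep[OF L2(2,3) weak(2) ae1 that] by (simp add: h1_def)
qed

lemma D0_iff:
  "(f, g) \<in> D0 L \<longleftrightarrow> sobolev 2 (ring_edge L) f \<and> sobolev 2 (halfline L) g \<and>
     continuous_rep (ring_edge L) f L = continuous_rep (ring_edge L) f (-L) \<and>
     continuous_rep (ring_edge L) f L = continuous_rep (halfline L) g L \<and>
     continuous_rep (ring_edge L) (weak_deriv (ring_edge L) f) L
       - continuous_rep (ring_edge L) (weak_deriv (ring_edge L) f) (-L)
       = continuous_rep (halfline L) (weak_deriv (halfline L) g) L"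
  by (simp only: D0_def H_graph_def Let_def mem_Collect_eq prod.case conj_assoc)

lemma L2_bounded_mult:
  assumes f: "L2 I f" and I: "I \<in> sets lebesgue" "compact (closure I)" and P: "continuous_on (closure I) P"
  shows "L2 I (\<lambda>x. of_real (P x) * f x)"
proof -
  have "bounded (P ` closure I)"
    using P I(2) by (intro compact_imp_bounded compact_continuous_image)
  then obtain B where B: "\<And>x. x \<in> I \<Longrightarrow> \<bar>P x\<bar> \<le> B"
    using closure_subset by (fastforce simp: bounded_iff)
  show ?thesis
  proof (rule L2_dominated)
    show "L2 I (\<lambda>x. of_real B * f x)" by (rule L2_cmult[OF f])
    have "(\<lambda>x. complex_of_real (P x)) \<in> borel_measurable (lebesgue_on I)"
      by (intro continuous_imp_measurable_on_sets_lebesgue continuous_intros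
          continuous_on_subset[OF P closure_subset] I)
    then show "(\<lambda>x. of_real (P x) * f x) \<in> borel_measurable (lebesgue_on I)"
      using f unfolding L2_def by (intro borel_measurable_times) auto
    show "cmod (of_real (P x) * f x) \<le> cmod (of_real B * f x)" if "x \<in> I" for x
      using B[OF that] by (simp only: norm_mult norm_of_real) (intro mult_right_mono, auto)
  qed
qed

locale single_lobe =
  fixes L c :: real and \<phi> \<psi> :: "real \<Rightarrow> real"
  assumes L_pos: "L > 0" and lobe: "positive_single_lobe L c \<phi> \<psi>"
begin

text \<open>Taking the real part loses nothing: by \<open>stationary_state_has_derivative\<close>
  this is the classical derivative of \<open>\<phi>\<close> on the closed ring.\<close>

definition \<phi>1 :: "real \<Rightarrow> real" where
  "\<phi>1 x = Re (continuous_rep (ring_edge L) (weak_deriv (ring_edge L) (complexify \<phi>)) x)"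

definition \<psi>1 :: "real \<Rightarrow> real" where
  "\<psi>1 x = Re (continuous_rep (halfline L) (weak_deriv (halfline L) (complexify \<psi>)) x)"

abbreviation V\<phi> :: "real \<Rightarrow> real" where "V\<phi> \<equiv> \<lambda>x. c - ln (\<bar>\<phi> x\<bar>\<^sup>2)"
abbreviation V\<psi> :: "real \<Rightarrow> real" where "V\<psi> \<equiv> \<lambda>x. c - ln (\<bar>\<psi> x\<bar>\<^sup>2)"

lemma closure_ring: "closure (ring_edge L) = {-L..L}"
  using L_pos by (simp add: closure_greaterThanLessThan)

lemma closure_halfline: "closure (halfline L) = {L..}"
  by (simp add: closure_greaterThan)

lemma ring_interval: "open (ring_edge L)" "is_interval (ring_edge L)" "ring_edge L \<noteq> {}"
  using L_pos by (auto simp: is_interval_oo)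

lemma halfline_interval: "open (halfline L)" "is_interval (halfline L)" "halfline L \<noteq> {}"
  by (auto simp: is_interval_oi)

lemma lobe_parts:
  "continuous_on {-L..L} \<phi>" "continuous_on {L..} \<psi>"
  "(complexify \<phi>, complexify \<psi>) \<in> D0 L"
  "stationary_eq (ring_edge L) c \<phi>" "stationary_eq (halfline L) c \<psi>"
  "x \<in> {-L..L} \<Longrightarrow> \<phi> x > 0" "x \<in> {L..} \<Longrightarrow> \<psi> x > 0"
  "monotone_on {L..} (<) (>) \<psi>"
proof -
  note l = lobe[unfolded positive_single_lobe_def]
  show "continuous_on {-L..L} \<phi>" "continuous_on {L..} \<psi>"
    "(complexify \<phi>, complexify \<psi>) \<in> D0 L"
    "stationary_eq (ring_edge L) c \<phi>" "stationary_eq (halfline L) c \<psi>"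
    "monotone_on {L..} (<) (>) \<psi>"
    using l by - (elim conjE, assumption)+
  from l have "\<forall>x\<in>{-L..L}. \<phi> x > 0" "\<forall>x\<in>{L..}. \<psi> x > 0"
    by - (elim conjE, assumption)+
  then show "x \<in> {-L..L} \<Longrightarrow> \<phi> x > 0" "x \<in> {L..} \<Longrightarrow> \<psi> x > 0" by blast+
qed

lemma sobolev_lobe: "sobolev 2 (ring_edge L) (complexify \<phi>)" "sobolev 2 (halfline L) (complexify \<psi>)"
  using lobe_parts(3)[unfolded D0_iff] by - (elim conjE, assumption)+

sublocale ring: edge_state "ring_edge L" \<phi> \<phi>1 V\<phi>
proof unfold_locales
  have pos: "\<phi> x > 0" if "x \<in> closure (ring_edge L)" for x
    using lobe_parts(6) that unfolding closure_ring .
  note s = stationary_state_has_derivative[OF ring_interval lobe_parts(1)[folded closure_ring] pos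
      sobolev_lobe(1) lobe_parts(4), folded \<phi>1_def]
  show "(\<phi> has_real_derivative \<phi>1 x) (at x within closure (ring_edge L))"
    "(\<phi>1 has_real_derivative V\<phi> x * \<phi> x) (at x within closure (ring_edge L))"
    "\<phi> x > 0" if "x \<in> closure (ring_edge L)" for x
    using s(1,2)[OF _ that] pos[OF that] by (simp_all add: \<phi>1_def[abs_def])
  have "-L \<in> closure (ring_edge L)" using L_pos by (simp add: closure_ring)
  then show "continuous_on (closure (ring_edge L)) V\<phi>" by (rule s(3)[rotated])
qed (rule ring_interval)+

sublocale half: edge_state "halfline L" \<psi> \<psi>1 V\<psi>
proof unfold_locales
  have pos: "\<psi> x > 0" if "x \<in> closure (halfline L)" for x
    using lobe_parts(7) that unfolding closure_halfline .
  note s = stationary_state_has_derivative[OF halfline_interval lobe_parts(2)[folded closure_halfline] pos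
      sobolev_lobe(2) lobe_parts(5), folded \<psi>1_def]
  show "(\<psi> has_real_derivative \<psi>1 x) (at x within closure (halfline L))"
    "(\<psi>1 has_real_derivative V\<psi> x * \<psi> x) (at x within closure (halfline L))"
    "\<psi> x > 0" if "x \<in> closure (halfline L)" for x
    using s(1,2)[OF _ that] pos[OF that] by (simp_all add: \<psi>1_def[abs_def])
  have "L \<in> closure (halfline L)" by (simp add: closure_halfline)
  then show "continuous_on (closure (halfline L)) V\<psi>" by (rule s(3)[rotated])
qed (rule halfline_interval)+

lemma rep_lobe:
  "x \<in> {-L..L} \<Longrightarrow> continuous_rep (ring_edge L) (complexify \<phi>) x = of_real (\<phi> x)"
  "x \<in> {L..} \<Longrightarrow> continuous_rep (halfline L) (complexify \<psi>) x = of_real (\<psi> x)"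
proof -
  have "continuous_on {-L..L} (complexify \<phi>)" "continuous_on {L..} (complexify \<psi>)"
    unfolding complexify_def by (intro continuous_intros lobe_parts)+
  then show "x \<in> {-L..L} \<Longrightarrow> continuous_rep (ring_edge L) (complexify \<phi>) x = of_real (\<phi> x)"
    "x \<in> {L..} \<Longrightarrow> continuous_rep (halfline L) (complexify \<psi>) x = of_real (\<psi> x)"
    using continuous_rep_eqI[OF ring_interval(1), of "complexify \<phi>" "complexify \<phi>" x]
      continuous_rep_eqI[OF halfline_interval(1), of "complexify \<psi>" "complexify \<psi>" x]
    by (auto simp: closure_ring closure_halfline complexify_def)
qed

lemma vertex: "\<phi> L = \<phi> (-L)" "\<phi> L = \<psi> L" "\<phi>1 L - \<phi>1 (-L) = \<psi>1 L"
proof -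
  have "complex_of_real (\<phi> L) = of_real (\<phi> (-L))" "complex_of_real (\<phi> L) = of_real (\<psi> L)"
    using lobe_parts(3) L_pos rep_lobe(1)[of L] rep_lobe(1)[of "-L"] rep_lobe(2)[of L]
    by (auto simp: D0_iff)
  then show "\<phi> L = \<phi> (-L)" "\<phi> L = \<psi> L" by (simp_all only: of_real_eq_iff)
  show "\<phi>1 L - \<phi>1 (-L) = \<psi>1 L"
    using lobe_parts(3) unfolding D0_iff \<phi>1_def \<psi>1_def by (simp flip: minus_complex.sel)
qed

lemma halfline_explicit:
  obtains k where "\<And>x. x \<ge> L \<Longrightarrow> \<psi>1 x / \<psi> x = k - x" "\<And>x. x \<ge> L \<Longrightarrow> V\<psi> x = (k - x)\<^sup>2 - 1"
proof -
  let ?H = "halfline L"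
  have int0: "(\<lambda>x. complex_of_real ((\<psi> x)\<^sup>2)) absolutely_integrable_on {L..}"
  proof -
    have "integrable (lebesgue_on ?H) (\<lambda>x. complex_of_real ((cmod (complexify \<psi> x))\<^sup>2))"
      using half.sobolev_parts(1)[OF sobolev_lobe(2)] unfolding L2_def by (intro integrable_of_real) simp
    from integral_closure_open_interval(1)[OF halfline_interval(1,2) this] show ?thesis
      by (simp add: closure_halfline complexify_def)
  qed
  have int1: "(\<lambda>x. complex_of_real ((\<psi>1 x)\<^sup>2)) absolutely_integrable_on {L..}"
  proof -
    have ae: "AE x in lebesgue_on ?H. weak_deriv ?H (complexify \<psi>) x =
        continuous_rep ?H (weak_deriv ?H (complexify \<psi>)) x"
      using half.rep_AE(2)[OF sobolev_lobe(2)] by eventually_elim simp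
    have rep: "L2 ?H (continuous_rep ?H (weak_deriv ?H (complexify \<psi>)))"
      by (rule L2_cong_AE[OF half.meas half.sobolev_parts(2)[OF sobolev_lobe(2)] ae])
    have "L2 ?H (\<lambda>x. of_real (\<psi>1 x))"
    proof (rule L2_dominated[OF rep])
      show "(\<lambda>x. complex_of_real (\<psi>1 x)) \<in> borel_measurable (lebesgue_on ?H)"
      proof -
        have [measurable]: "continuous_rep ?H (weak_deriv ?H (complexify \<psi>)) \<in> borel_measurable (lebesgue_on ?H)"
          using rep by (simp add: L2_def)
        show ?thesis unfolding \<psi>1_def by measurable
      qed
      show "cmod (of_real (\<psi>1 x)) \<le> cmod (continuous_rep ?H (weak_deriv ?H (complexify \<psi>)) x)" for x
        by (simp add: \<psi>1_def abs_Re_le_cmod)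
    qed
    then have "integrable (lebesgue_on ?H) (\<lambda>x. complex_of_real ((cmod (of_real (\<psi>1 x)))\<^sup>2))"
      unfolding L2_def by (intro integrable_of_real) simp
    from integral_closure_open_interval(1)[OF halfline_interval(1,2) this] show ?thesis
      by (simp add: closure_halfline)
  qed
  show ?thesis
  proof (rule halfline_state[OF _ _ _ _ int0 int1, of c])
    fix x assume "L \<le> x"
    then have x: "x \<in> closure (halfline L)" by (simp add: closure_halfline)
    show "(\<psi> has_real_derivative \<psi>1 x) (at x within {L..})"
      using half.deriv[OF x] unfolding closure_halfline .
    show "(\<psi>1 has_real_derivative V\<psi> x * \<psi> x) (at x within {L..})"
      using half.deriv2[OF x] unfolding closure_halfline .
    show "\<psi> x > 0" by (rule half.pos[OF x])
  next
    fix x y assume "L \<le> x" "x \<le> y"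
    then show "\<psi> y \<le> \<psi> x"
      using lobe_parts(8) unfolding monotone_on_def by (cases "x = y") (auto simp: order_less_imp_le)
  qed (rule that)
qed

text \<open>On the compact ring the factors are bounded. On the half-line put
  \<open>t = k - x\<close>: both \<open>|t|\<close> and \<open>|t^2 - 1|\<close> are at most
  \<open>t^2 + 1\<close>, so \<open>q\<close> and \<open>V\<close> obey the same bound
  \<open>2 * k^2 + 1 + 2 * x^2\<close>.\<close>

lemma log_domain_weights:
  assumes "(f, g) \<in> log_domain L"
  shows "L2 (ring_edge L) (\<lambda>x. of_real (V\<phi> x) * f x)"
    and "L2 (ring_edge L) (\<lambda>x. of_real (ring.q x) * f x)"
    and "L2 (halfline L) (\<lambda>x. of_real (V\<psi> x) * g x)"
    and "L2 (halfline L) (\<lambda>x. of_real (half.q x) * g x)"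
proof -
  have sob: "sobolev 2 (ring_edge L) f" "sobolev 2 (halfline L) g"
    and x2: "L2 (halfline L) (\<lambda>x. x\<^sup>2 *\<^sub>R g x)"
    using assms by (auto simp: log_domain_def D0_iff)
  have comp: "compact (closure (ring_edge L))" by (simp add: closure_ring)
  show "L2 (ring_edge L) (\<lambda>x. of_real (V\<phi> x) * f x)" "L2 (ring_edge L) (\<lambda>x. of_real (ring.q x) * f x)"
    by (intro L2_bounded_mult ring.sobolev_parts(1) sob ring.meas comp ring.V_cont ring.q_cont)+
  obtain k where k: "\<And>x. x \<ge> L \<Longrightarrow> \<psi>1 x / \<psi> x = k - x" "\<And>x. x \<ge> L \<Longrightarrow> V\<psi> x = (k - x)\<^sup>2 - 1"
    using halfline_explicit by blast
  have sq: "(k - x)\<^sup>2 \<le> 2 * k\<^sup>2 + 2 * x\<^sup>2" for x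
    using zero_le_power2[of "k + x"] by (simp add: power2_eq_square algebra_simps)
  note H = half.sobolev_parts(1)[OF sob(2)] x2 half.meas
  show "L2 (halfline L) (\<lambda>x. of_real (V\<psi> x) * g x)"
  proof (rule L2_polynomial_weight[OF H, of _ "2 * k\<^sup>2 + 1" 2])
    show "continuous_on (halfline L) V\<psi>"
      using half.V_cont closure_subset by (rule continuous_on_subset)
    show "\<bar>V\<psi> x\<bar> \<le> 2 * k\<^sup>2 + 1 + 2 * x\<^sup>2" if "x \<in> halfline L" for x
    proof -
      have "V\<psi> x = (k - x)\<^sup>2 - 1" using k(2)[of x] that by simp
      then show ?thesis
        using sq[of x] zero_le_power2[of "k - x"] zero_le_power2[of k] zero_le_power2[of x] by linarith
    qed
  qed
  show "L2 (halfline L) (\<lambda>x. of_real (half.q x) * g x)"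
  proof (rule L2_polynomial_weight[OF H, of _ "2 * k\<^sup>2 + 1" 2])
    show "continuous_on (halfline L) half.q"
      using half.q_cont closure_subset by (rule continuous_on_subset)
    show "\<bar>half.q x\<bar> \<le> 2 * k\<^sup>2 + 1 + 2 * x\<^sup>2" if "x \<in> halfline L" for x
    proof -
      have "\<bar>k - x\<bar> \<le> (k - x)\<^sup>2 + 1"
        using zero_le_power2[of "\<bar>k - x\<bar> - 1"] zero_le_power2[of "k - x"]
        by (simp add: power2_diff)
      then show ?thesis using k(1)[of x] sq[of x] that by simp
    qed
  qed
qed

lemma quadratic_form:
  assumes "(f, g) \<in> log_domain L"
  shows "op_L2 L c \<phi> \<psi> (f, g) \<in> L2_graph L"
    and "graph_inner L (op_L2 L c \<phi> \<psi> (f, g)) (f, g) = of_real (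
      (LINT x|lebesgue_on (ring_edge L). (cmod (edge_defect (ring_edge L) ring.q f x))\<^sup>2) +
      (LINT x|lebesgue_on (halfline L). (cmod (edge_defect (halfline L) half.q g x))\<^sup>2))"
proof -
  have sob: "sobolev 2 (ring_edge L) f" "sobolev 2 (halfline L) g" and D: "(f, g) \<in> D0 L"
    using assms by (auto simp: log_domain_def D0_iff)
  note W = log_domain_weights[OF assms]
  note R = ring.edge_integrals[OF sob(1) W(1,2)] and H = half.edge_integrals[OF sob(2) W(3,4)]
  show "op_L2 L c \<phi> \<psi> (f, g) \<in> L2_graph L"
    using R(1) H(1) by (simp add: op_L2_def L2_graph_def)
  let ?F = "edge_flux (ring_edge L) ring.q f" and ?G = "edge_flux (halfline L) half.q g"
  have "?F L = ?F (-L) + ((LINT x|lebesgue_on (ring_edge L). schroedinger (ring_edge L) V\<phi> f x * cnj (f x))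
      - of_real (LINT x|lebesgue_on (ring_edge L). (cmod (edge_defect (ring_edge L) ring.q f x))\<^sup>2))"
    using primitive_onD(2)[OF ring.edge_flux_primitive[OF sob(1)], of "-L" L] R(5) L_pos
    by (simp only: closure_ring) simp
  moreover have "(LINT x|lebesgue_on (halfline L). schroedinger (halfline L) V\<psi> g x * cnj (g x))
      - of_real (LINT x|lebesgue_on (halfline L). (cmod (edge_defect (halfline L) half.q g x))\<^sup>2) = - ?G L"
    using primitive_on_halfline_integral[of L, OF _ H(2,4)[unfolded closure_halfline]]
      half.edge_flux_primitive[OF sob(2)] H(5) by (simp only: closure_halfline)
  \<comment> \<open>All three vertex values of \<open>(f, g)\<close> equal \<open>v\<close>, so its
    Kirchhoff condition removes the derivative terms and leaves only the jump of \<open>q\<close>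
    times \<open>v * cnj v\<close>.\<close>
  moreover have "?F L - ?F (-L) - ?G L = 0"
  proof -
    define v where "v = continuous_rep (halfline L) g L"
    define a where "a = continuous_rep (ring_edge L) (weak_deriv (ring_edge L) f) L"
    define b where "b = continuous_rep (ring_edge L) (weak_deriv (ring_edge L) f) (-L)"
    have v: "continuous_rep (ring_edge L) f L = v" "continuous_rep (ring_edge L) f (-L) = v"
      and ab: "continuous_rep (halfline L) (weak_deriv (halfline L) g) L = a - b"
      using D by (auto simp: D0_iff v_def a_def b_def)
    \<comment> \<open>The three vertex values of the state coincide, so its Kirchhoff condition may
      be divided by them.\<close>
    have q: "ring.q L - ring.q (-L) - half.q L = 0"
      using vertex by (simp flip: diff_divide_distrib)
    have "?F L - ?F (-L) - ?G L = of_real (ring.q L - ring.q (-L) - half.q L) * (v * cnj v)"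
      by (simp add: edge_flux_def v ab flip: v_def a_def b_def) (simp add: algebra_simps)
    then show ?thesis unfolding q by simp
  qed
  ultimately show "graph_inner L (op_L2 L c \<phi> \<psi> (f, g)) (f, g) = of_real (
      (LINT x|lebesgue_on (ring_edge L). (cmod (edge_defect (ring_edge L) ring.q f x))\<^sup>2) +
      (LINT x|lebesgue_on (halfline L). (cmod (edge_defect (halfline L) half.q g x))\<^sup>2))"
    unfolding graph_inner_def op_L2_def fst_conv snd_conv of_real_add by algebra
qed

lemma nonneg: "nonneg_operator L (log_domain L) (op_L2 L c \<phi> \<psi>)"
  unfolding nonneg_operator_def
proof
  fix u assume u: "u \<in> log_domain L"
  obtain f g where fg: "u = (f, g)" by fastforce
  show "op_L2 L c \<phi> \<psi> u \<in> L2_graph L \<and> graph_inner L (op_L2 L c \<phi> \<psi> u) u \<in> \<real> \<and>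
      0 \<le> Re (graph_inner L (op_L2 L c \<phi> \<psi> u) u)"
    using quadratic_form[of f g] u unfolding fg by (simp add: integral_nonneg_AE)
qed

section \<open>The kernel\<close>

lemma kernel_subset_span:
  assumes "u \<in> graph_kernel L (log_domain L) (op_L2 L c \<phi> \<psi>)"
  shows "u \<in> graph_span L (complexify \<phi>, complexify \<psi>)"
proof -
  obtain f g where u: "u = (f, g)" by fastforce
  have dom: "(f, g) \<in> log_domain L"
    and T: "AE x in lebesgue_on (ring_edge L). schroedinger (ring_edge L) V\<phi> f x = 0"
           "AE x in lebesgue_on (halfline L). schroedinger (halfline L) V\<psi> g x = 0"
    using assms by (auto simp: u graph_kernel_def graph_ae_eq_def op_L2_def)
  have sob: "sobolev 2 (ring_edge L) f" "sobolev 2 (halfline L) g" and D: "(f, g) \<in> D0 L"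
    using dom by (auto simp: log_domain_def D0_iff)
  note W = log_domain_weights[OF dom]
  note R = ring.edge_integrals[OF sob(1) W(1,2)] and H = half.edge_integrals[OF sob(2) W(3,4)]
  define A where "A = (LINT x|lebesgue_on (ring_edge L). (cmod (edge_defect (ring_edge L) ring.q f x))\<^sup>2)"
  define B where "B = (LINT x|lebesgue_on (halfline L). (cmod (edge_defect (halfline L) half.q g x))\<^sup>2)"
  have "(LINT x|lebesgue_on (ring_edge L). schroedinger (ring_edge L) V\<phi> f x * cnj (f x)) = 0"
    using T(1) by (intro integral_eq_zero_AE) (auto elim: eventually_mono)
  moreover have "(LINT x|lebesgue_on (halfline L). schroedinger (halfline L) V\<psi> g x * cnj (g x)) = 0"
    using T(2) by (intro integral_eq_zero_AE) (auto elim: eventually_mono)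
  \<comment> \<open>No mixed term couples the edges in the form, so the two nonnegative integrals
    must vanish separately.\<close>
  ultimately have "complex_of_real (A + B) = 0"
    using quadratic_form(2)[OF dom] by (simp add: graph_inner_def op_L2_def A_def B_def)
  then have "A + B = 0" by (simp only: of_real_eq_0_iff)
  moreover have "A \<ge> 0" "B \<ge> 0" by (simp_all add: A_def B_def)
  ultimately have "A = 0" "B = 0" by linarith+
  then have "AE x in lebesgue_on (ring_edge L). edge_defect (ring_edge L) ring.q f x = 0"
    "AE x in lebesgue_on (halfline L). edge_defect (halfline L) half.q g x = 0"
    using integral_nonneg_eq_0_iff_AE[OF R(3)] integral_nonneg_eq_0_iff_AE[OF H(3)]
    by (simp_all add: A_def B_def)
  then obtain z w where z: "\<And>x. x \<in> {-L..L} \<Longrightarrow> continuous_rep (ring_edge L) f x = z * of_real (\<phi> x)"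
    and w: "\<And>x. x \<in> {L..} \<Longrightarrow> continuous_rep (halfline L) g x = w * of_real (\<psi> x)"
    using ring.edge_defect_zero_imp_multiple[OF sob(1)] half.edge_defect_zero_imp_multiple[OF sob(2)]
    unfolding closure_ring closure_halfline by metis
  have "z * of_real (\<psi> L) = w * of_real (\<psi> L)"
  proof -
    have "continuous_rep (ring_edge L) f L = continuous_rep (halfline L) g L"
      using D unfolding D0_iff by blast
    then show ?thesis using z[of L] w[of L] L_pos vertex(2) by simp
  qed
  then have "z = w" using lobe_parts(7)[of L] by simp
  have "AE x in lebesgue_on (ring_edge L). f x = z * complexify \<phi> x"
    by (rule lebesgue_on_mono[OF ring.rep_AE(1)[OF sob(1)]]) (simp add: z complexify_def)
  moreover have "AE x in lebesgue_on (halfline L). g x = z * complexify \<psi> x"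
    by (rule lebesgue_on_mono[OF half.rep_AE(1)[OF sob(2)]]) (simp add: w \<open>z = w\<close> complexify_def)
  ultimately show ?thesis
    by (auto simp: u graph_span_def graph_ae_eq_def)
qed

text \<open>The nonlinear term is a logarithm times the state, so the linear operator applied to the
  state reproduces the left side of the stationary equation.\<close>

lemma stationary_AE:
  "AE x in lebesgue_on (ring_edge L). schroedinger (ring_edge L) V\<phi> (complexify \<phi>) x = 0"
  "AE x in lebesgue_on (halfline L). schroedinger (halfline L) V\<psi> (complexify \<psi>) x = 0"
proof -
  have "schroedinger I (\<lambda>x. c - ln (\<bar>v x\<bar>\<^sup>2)) (complexify v) x =
      - weak_deriv I (weak_deriv I (complexify v)) x + of_real (c * v x - ln ((v x)\<^sup>2) * v x)" for I v x
    by (simp add: schroedinger_def complexify_def left_diff_distrib)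
  then show "AE x in lebesgue_on (ring_edge L). schroedinger (ring_edge L) V\<phi> (complexify \<phi>) x = 0"
    "AE x in lebesgue_on (halfline L). schroedinger (halfline L) V\<psi> (complexify \<psi>) x = 0"
    using lobe_parts(4,5) by (simp_all add: stationary_eq_def)
qed

text \<open>
  Since \<open>\<psi>'' = V \<psi>\<close> is square-integrable and \<open>V\<close> is quadratic, the weight comes for free.
\<close>

lemma weighted_lobe: "L2 (halfline L) (\<lambda>x. x\<^sup>2 *\<^sub>R complexify \<psi> x)"
proof -
  let ?H = "halfline L"
  let ?f2 = "weak_deriv ?H (weak_deriv ?H (complexify \<psi>))"
  note sob = half.sobolev_parts[OF sobolev_lobe(2)]
  have "AE x in lebesgue_on ?H. ?f2 x = of_real (V\<psi> x) * complexify \<psi> x"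
    using stationary_AE(2) by eventually_elim (simp add: schroedinger_def)
  from L2_cong_AE[OF half.meas sob(3) this]
  have V: "L2 ?H (\<lambda>x. of_real (V\<psi> x) * complexify \<psi> x)" .
  obtain k where k: "\<And>x. x \<ge> L \<Longrightarrow> V\<psi> x = (k - x)\<^sup>2 - 1"
    using halfline_explicit by blast
  show ?thesis
  proof (rule L2_dominated)
    show "L2 ?H (\<lambda>x. 2 * (of_real (V\<psi> x) * complexify \<psi> x) + of_real (2 + 2 * k\<^sup>2) * complexify \<psi> x)"
      by (intro L2_add L2_cmult V sob(1))
    have "(\<lambda>x. complex_of_real (x\<^sup>2)) \<in> borel_measurable (lebesgue_on ?H)"
      by (intro continuous_imp_measurable_on_sets_lebesgue continuous_intros half.meas)
    then show "(\<lambda>x. x\<^sup>2 *\<^sub>R complexify \<psi> x) \<in> borel_measurable (lebesgue_on ?H)"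
      using sob(1) unfolding L2_def scaleR_conv_of_real by (intro borel_measurable_times) auto
    show "cmod (x\<^sup>2 *\<^sub>R complexify \<psi> x) \<le>
        cmod (2 * (of_real (V\<psi> x) * complexify \<psi> x) + of_real (2 + 2 * k\<^sup>2) * complexify \<psi> x)"
      if "x \<in> ?H" for x
    proof -
      have "2 * (of_real (V\<psi> x) * complexify \<psi> x) + of_real (2 + 2 * k\<^sup>2) * complexify \<psi> x
          = of_real (2 * V\<psi> x + 2 + 2 * k\<^sup>2) * complexify \<psi> x"
        by (simp add: algebra_simps)
      \<comment> \<open>Since \<open>V = (k - x)^2 - 1\<close>, the difference of the two sides is
        \<open>(2 * k - x)^2\<close>; this is the origin of the constants \<open>2\<close> and
        \<open>2 + 2 * k^2\<close>.\<close>
      moreover have "x\<^sup>2 \<le> 2 * V\<psi> x + 2 + 2 * k\<^sup>2"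
        using k[of x] that zero_le_power2[of "2 * k - x"] by (simp add: power2_eq_square algebra_simps)
      ultimately show ?thesis
        by (simp only: norm_mult norm_of_real norm_scaleR) (intro mult_right_mono, auto)
    qed
  qed
qed

lemma span_subset_kernel:
  assumes "u \<in> graph_span L (complexify \<phi>, complexify \<psi>)"
  shows "u \<in> graph_kernel L (log_domain L) (op_L2 L c \<phi> \<psi>)"
proof -
  obtain f g where u: "u = (f, g)" by fastforce
  obtain z where "AE x in lebesgue_on (ring_edge L). f x = z * complexify \<phi> x"
    "AE x in lebesgue_on (halfline L). g x = z * complexify \<psi> x"
    using assms by (auto simp: u graph_span_def graph_ae_eq_def)
  then have f: "AE x in lebesgue_on (ring_edge L). z * complexify \<phi> x = f x"
    and g: "AE x in lebesgue_on (halfline L). z * complexify \<psi> x = g x"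
    by (auto elim: eventually_mono)
  note F = sobolev_2_multiple[OF ring_interval sobolev_lobe(1) f, unfolded closure_ring]
  note G = sobolev_2_multiple[OF halfline_interval sobolev_lobe(2) g, unfolded closure_halfline]
  have pts: "L \<in> {-L..L}" "-L \<in> {-L..L}" "L \<in> {L..}" using L_pos by auto
  note lobe_vertex = lobe_parts(3)[unfolded D0_iff]
  \<comment> \<open>The vertex conditions are homogeneous: once every vertex value is written as
    \<open>z\<close> times that of the state, the conditions of the state apply.\<close>
  have "(f, g) \<in> D0 L"
    unfolding D0_iff F(3)[OF pts(1)] F(3)[OF pts(2)] F(4)[OF pts(1)] F(4)[OF pts(2)] G(3)[OF pts(3)] G(4)[OF pts(3)]
      right_diff_distrib[symmetric]
    using F(1) G(1) lobe_vertex by metis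
  moreover have "L2 (halfline L) (\<lambda>x. x\<^sup>2 *\<^sub>R g x)"
  proof (rule L2_cong_AE[OF half.meas L2_cmult[OF weighted_lobe]])
    show "AE x in lebesgue_on (halfline L). z * (x\<^sup>2 *\<^sub>R complexify \<psi> x) = x\<^sup>2 *\<^sub>R g x"
      using g
    proof eventually_elim
      case (elim x)
      show ?case unfolding elim[symmetric] by simp
    qed
  qed
  moreover have "AE x in lebesgue_on (ring_edge L). schroedinger (ring_edge L) V\<phi> f x = 0"
    using stationary_AE(1) F(2) f
  proof eventually_elim
    case (elim x)
    have "schroedinger (ring_edge L) V\<phi> f x = z * schroedinger (ring_edge L) V\<phi> (complexify \<phi>) x"
      unfolding schroedinger_def elim(2,3)[symmetric] by (simp add: algebra_simps)
    then show ?case using elim(1) by simp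
  qed
  moreover have "AE x in lebesgue_on (halfline L). schroedinger (halfline L) V\<psi> g x = 0"
    using stationary_AE(2) G(2) g
  proof eventually_elim
    case (elim x)
    have "schroedinger (halfline L) V\<psi> g x = z * schroedinger (halfline L) V\<psi> (complexify \<psi>) x"
      unfolding schroedinger_def elim(2,3)[symmetric] by (simp add: algebra_simps)
    then show ?case using elim(1) by simp
  qed
  ultimately show ?thesis
    by (simp add: u graph_kernel_def log_domain_def graph_ae_eq_def op_L2_def)
qed

end

theorem theorem1p4:
  fixes L c :: real and \<phi> \<psi> :: "real \<Rightarrow> real"
  assumes "L > 0"
    and "positive_single_lobe L c \<phi> \<psi>"
  shows "graph_kernel L (log_domain L) (op_L2 L c \<phi> \<psi>) = graph_span L (complexify \<phi>, complexify \<psi>) \<and>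
         nonneg_operator L (log_domain L) (op_L2 L c \<phi> \<psi>)"
proof -
  interpret single_lobe L c \<phi> \<psi> by unfold_locales fact+
  show ?thesis
  proof (rule conjI[OF _ nonneg], intro set_eqI iffI)
  qed (rule kernel_subset_span span_subset_kernel, assumption)+
qed

end
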